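(* Let $p=q=1$ and let $\alpha_0,\alpha_1,\beta_1$ be strictly positive. Let $(V_t)_{t\ge0}$ be the volatility process with parameters $B=-\beta_1$, $\mathbf a=\alpha_1$, $\alpha_0$ and driving Lévy process $L$, that is, $V_t=\alpha_0+\alpha_1\mathbf Y_{t-}$ for $t>0$, $V_0=\alpha_0+\alpha_1\mathbf Y_0$, where $d\mathbf Y_t=-\beta_1\mathbf Y_{t-}\,dt+(\alpha_0+\alpha_1\mathbf Y_{t-})\,d[L,L]^{(d)}_t$, with $V$ nonnegative, and let $(G_t)_{t\ge0}$ be given by $G_0=0$, $dG_t=\sqrt{V_t}\,dL_t$. Put $\omega_0=\alpha_0\beta_1$, $\omega_1=\alpha_1e^{-\beta_1}$, $\eta=\beta_1$, and $$X_t=\eta t-\sum_{0<s\le t}\log\bigl(1+\omega_1e^{\eta}(\Delta L_s)^2\bigr),\qquad \sigma_t^2=\Bigl(\sigma_0^2+\omega_0\int_0^te^{X_s}\,ds\Bigr)e^{-X_{t-}},\quad t\ge0,$$ with $\sigma_0^2=V_0$. Then $(V_t)_{t\ge0}$ is the process $(\sigma_t^2)_{t\ge0}$, and $(G_t)_{t\ge0}$ is the process defined by $G_0=0$, $dG_t=\sigma_t\,dL_t$, $t>0$.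
   Context: $L=(L_t)_{t\ge0}$ is a real-valued (càdlàg) Lévy process with nontrivial (nonzero) Lévy measure, $\Delta L_t=L_t-L_{t-}$, and $[L,L]^{(d)}_t=\sum_{0<s\le t}(\Delta L_s)^2$ is the discrete part of its quadratic covariation. The state process $\mathbf Y$ is the unique càdlàg solution of the displayed stochastic differential equation with initial value $\mathbf Y_0$ a real random variable independent of $L$. Stochastic integrals are taken with respect to the smallest right-continuous filtration such that $\mathcal F_0$ contains all null sets, $L$ is adapted and $\mathbf Y_0$ is $\mathcal F_0$-measurable. $X_{0-}=0$, and $\sigma_t=\sqrt{\sigma_t^2}$ is the nonnegative root. *)

theory Defs
  imports "HOL-Probability.Probability"
begin

section \<open>Paths\<close>

text \<open>Processes are indexed by real, but only times t \<ge> 0 matter.\<close>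

definition cadlag :: "(real \<Rightarrow> real) \<Rightarrow> bool" where
  "cadlag f \<longleftrightarrow> (\<forall>t\<ge>0. continuous (at_right t) f) \<and> (\<forall>t>0. \<exists>l. (f \<longlongrightarrow> l) (at_left t))"

definition caglad :: "(real \<Rightarrow> real) \<Rightarrow> bool" where
  "caglad f \<longleftrightarrow> (\<forall>t>0. continuous (at_left t) f) \<and> (\<forall>t\<ge>0. \<exists>l. (f \<longlongrightarrow> l) (at_right t))"

text \<open>The left limit at 0 is 0 by convention, as in $X_{0-} = 0$.\<close>

definition left_limit :: "(real \<Rightarrow> real) \<Rightarrow> real \<Rightarrow> real" where
  "left_limit f t = (if t > 0 then Lim (at_left t) f else 0)"

definition jump :: "(real \<Rightarrow> real) \<Rightarrow> real \<Rightarrow> real" where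
  "jump f t = f t - left_limit f t"


section \<open>Levy processes\<close>

definition levy_process :: "'a measure \<Rightarrow> (real \<Rightarrow> 'a \<Rightarrow> real) \<Rightarrow> bool" where
  "levy_process M L \<longleftrightarrow>
     prob_space M \<and>
     (\<forall>t\<ge>0. L t \<in> borel_measurable M) \<and>
     (AE \<omega> in M. L 0 \<omega> = 0) \<and>
     (\<forall>(n::nat) (\<tau>::nat \<Rightarrow> real). 0 \<le> \<tau> 0 \<longrightarrow> mono \<tau> \<longrightarrow>
        prob_space.indep_vars M (\<lambda>_. borel) (\<lambda>i \<omega>. L (\<tau> (Suc i)) \<omega> - L (\<tau> i) \<omega>) {..<n}) \<and>
     (\<forall>s\<ge>0. \<forall>t\<ge>0. distr M borel (\<lambda>\<omega>. L (s + t) \<omega> - L s \<omega>) = distr M borel (L t)) \<and>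
     (\<forall>t\<ge>0. \<forall>\<epsilon>>0. ((\<lambda>s. measure M {\<omega> \<in> space M. \<bar>L s \<omega> - L t \<omega>\<bar> > \<epsilon>}) \<longlongrightarrow> 0) (at t within {0..})) \<and>
     (AE \<omega> in M. cadlag (\<lambda>t. L t \<omega>))"

text \<open>Expected number of jumps per unit of time with size in a given Borel set.\<close>

definition levy_measure :: "'a measure \<Rightarrow> (real \<Rightarrow> 'a \<Rightarrow> real) \<Rightarrow> real measure" where
  "levy_measure M L = measure_of UNIV (sets borel)
     (\<lambda>A. \<integral>\<^sup>+ \<omega>. emeasure (count_space UNIV)
        {s \<in> {0<..1}. jump (\<lambda>u. L u \<omega>) s \<in> A - {0}} \<partial>M)"

definition discrete_quadratic_variation :: "(real \<Rightarrow> 'a \<Rightarrow> real) \<Rightarrow> real \<Rightarrow> 'a \<Rightarrow> real" where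
  "discrete_quadratic_variation L t \<omega> = (\<Sum>\<^sub>\<infinity>s\<in>{0<..t}. (jump (\<lambda>u. L u \<omega>) s)\<^sup>2)"


section \<open>The filtration\<close>

definition adapted :: "(real \<Rightarrow> 'a measure) \<Rightarrow> (real \<Rightarrow> 'a \<Rightarrow> real) \<Rightarrow> bool" where
  "adapted F X \<longleftrightarrow> (\<forall>t\<ge>0. X t \<in> borel_measurable (F t))"

definition admissible_filtration ::
  "'a measure \<Rightarrow> (real \<Rightarrow> 'a \<Rightarrow> real) \<Rightarrow> ('a \<Rightarrow> real) \<Rightarrow> (real \<Rightarrow> 'a measure) \<Rightarrow> bool" where
  "admissible_filtration M L U F \<longleftrightarrow>
     filtration (space M) F \<and>
     (\<forall>t. sets (F t) \<subseteq> sets M) \<and>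
     (\<forall>t\<ge>0. sets (F t) = (\<Inter>u\<in>{t<..}. sets (F u))) \<and>
     null_sets M \<subseteq> sets (F 0) \<and>
     adapted F L \<and>
     U \<in> borel_measurable (F 0)"

definition smallest_filtration ::
  "'a measure \<Rightarrow> (real \<Rightarrow> 'a \<Rightarrow> real) \<Rightarrow> ('a \<Rightarrow> real) \<Rightarrow> (real \<Rightarrow> 'a measure) \<Rightarrow> bool" where
  "smallest_filtration M L U F \<longleftrightarrow>
     admissible_filtration M L U F \<and>
     (\<forall>F'. admissible_filtration M L U F' \<longrightarrow> (\<forall>t\<ge>0. sets (F t) \<subseteq> sets (F' t)))"


section \<open>Stochastic integrals of left-continuous integrands\<close>

text \<open>
  The stochastic integral is the continuous extension, for uniform convergence on compacts in
  probability (ucp), of the elementary integral of simple predictable processes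
  $$H = h\,1_{\{0\}} + \sum_{i<n} H_i\,1_{(T_i, T_{i+1}]}$$
  (see Protter, Stochastic Integration and Differential Equations, Chapter II) to adapted
  processes with left-continuous paths having right limits. All integrals are over $(0,t]$, so
  that the value of the integrand at time 0 does not contribute.
\<close>

record 'a simple_integrand =
  pieces :: nat
  initial :: "'a \<Rightarrow> real"
  nodes :: "nat \<Rightarrow> 'a \<Rightarrow> real"
  weights :: "nat \<Rightarrow> 'a \<Rightarrow> real"

definition simple_predictable ::
  "'a measure \<Rightarrow> (real \<Rightarrow> 'a measure) \<Rightarrow> 'a simple_integrand \<Rightarrow> bool" where
  "simple_predictable M F K \<longleftrightarrow>
     initial K \<in> borel_measurable (F 0) \<and>
     (\<forall>\<omega>\<in>space M. nodes K 0 \<omega> = 0) \<and>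
     (\<forall>i<pieces K. \<forall>\<omega>\<in>space M. nodes K i \<omega> \<le> nodes K (Suc i) \<omega>) \<and>
     (\<forall>i\<le>pieces K. stopping_time F (nodes K i)) \<and>
     (\<forall>i<pieces K. weights K i \<in> borel_measurable (filtration.pre_sigma (space M) F (nodes K i)))"

definition simple_process :: "'a simple_integrand \<Rightarrow> real \<Rightarrow> 'a \<Rightarrow> real" where
  "simple_process K t \<omega> = (if t = 0 then initial K \<omega> else 0) +
     (\<Sum>i<pieces K. if nodes K i \<omega> < t \<and> t \<le> nodes K (Suc i) \<omega> then weights K i \<omega> else 0)"

definition simple_integral ::
  "(real \<Rightarrow> 'a \<Rightarrow> real) \<Rightarrow> 'a simple_integrand \<Rightarrow> real \<Rightarrow> 'a \<Rightarrow> real" where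
  "simple_integral X K t \<omega> =
     (\<Sum>i<pieces K. weights K i \<omega> *
        (X (min (nodes K (Suc i) \<omega>) t) \<omega> - X (min (nodes K i \<omega>) t) \<omega>))"

text \<open>
  The set below is the event that the supremum of the distance over $[0,t]$ exceeds $\epsilon$.
  It is measurable in all uses: the probability space is complete, and the difference of the two
  processes has almost surely one-sidedly continuous paths.
\<close>

definition ucp_tendsto ::
  "'a measure \<Rightarrow> (nat \<Rightarrow> real \<Rightarrow> 'a \<Rightarrow> real) \<Rightarrow> (real \<Rightarrow> 'a \<Rightarrow> real) \<Rightarrow> bool" where
  "ucp_tendsto M H H' \<longleftrightarrow> (\<forall>t\<ge>0. \<forall>\<epsilon>>0.
     (\<lambda>n. measure M {\<omega> \<in> space M. \<exists>s\<in>{0..t}. \<bar>H n s \<omega> - H' s \<omega>\<bar> > \<epsilon>}) \<longlonglongrightarrow> 0)"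

text \<open>
  In the next definition Z is (a version of) the integral process of H with respect to X: there
  are simple processes converging to H, and for all such sequences the elementary integrals
  converge to Z. For a semimartingale X this holds for exactly one Z up to indistinguishability.
\<close>

definition stochastic_integral ::
  "'a measure \<Rightarrow> (real \<Rightarrow> 'a measure) \<Rightarrow> (real \<Rightarrow> 'a \<Rightarrow> real) \<Rightarrow> (real \<Rightarrow> 'a \<Rightarrow> real)
     \<Rightarrow> (real \<Rightarrow> 'a \<Rightarrow> real) \<Rightarrow> bool" where
  "stochastic_integral M F X H Z \<longleftrightarrow>
     adapted F X \<and> (AE \<omega> in M. cadlag (\<lambda>t. X t \<omega>)) \<and>
     adapted F H \<and> (AE \<omega> in M. caglad (\<lambda>t. H t \<omega>)) \<and>
     adapted F Z \<and> (AE \<omega> in M. cadlag (\<lambda>t. Z t \<omega>)) \<and>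
     (\<exists>K. (\<forall>n. simple_predictable M F (K n)) \<and> ucp_tendsto M (\<lambda>n. simple_process (K n)) H) \<and>
     (\<forall>K. (\<forall>n. simple_predictable M F (K n)) \<and> ucp_tendsto M (\<lambda>n. simple_process (K n)) H \<longrightarrow>
        ucp_tendsto M (\<lambda>n. simple_integral X (K n)) Z)"


section \<open>COGARCH processes\<close>

text \<open>
  The stochastic differential equation
  $dY_t = B Y_{t-}\,dt + (\alpha_0 + a Y_{t-})\,d[L,L]^{(d)}_t$ in integrated form.
\<close>

definition state_process ::
  "'a measure \<Rightarrow> (real \<Rightarrow> 'a measure) \<Rightarrow> (real \<Rightarrow> 'a \<Rightarrow> real) \<Rightarrow> real \<Rightarrow> real \<Rightarrow> real
     \<Rightarrow> (real \<Rightarrow> 'a \<Rightarrow> real) \<Rightarrow> bool" where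
  "state_process M F L B a \<alpha>\<^sub>0 Y \<longleftrightarrow>
     adapted F Y \<and> (AE \<omega> in M. cadlag (\<lambda>t. Y t \<omega>)) \<and>
     (\<exists>Z. stochastic_integral M F (discrete_quadratic_variation L)
            (\<lambda>t \<omega>. \<alpha>\<^sub>0 + a * left_limit (\<lambda>s. Y s \<omega>) t) Z \<and>
        (AE \<omega> in M. \<forall>t\<ge>0.
           Y t \<omega> = Y 0 \<omega> + (LINT s:{0..t}|lborel. B * left_limit (\<lambda>u. Y u \<omega>) s) + Z t \<omega>))"

definition volatility :: "real \<Rightarrow> real \<Rightarrow> (real \<Rightarrow> 'a \<Rightarrow> real) \<Rightarrow> real \<Rightarrow> 'a \<Rightarrow> real" where
  "volatility a \<alpha>\<^sub>0 Y t \<omega> =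
     (if t = 0 then \<alpha>\<^sub>0 + a * Y 0 \<omega> else \<alpha>\<^sub>0 + a * left_limit (\<lambda>s. Y s \<omega>) t)"

definition cogarch_X :: "(real \<Rightarrow> 'a \<Rightarrow> real) \<Rightarrow> real \<Rightarrow> real \<Rightarrow> real \<Rightarrow> 'a \<Rightarrow> real" where
  "cogarch_X L \<omega>\<^sub>1 \<eta> t \<omega> =
     \<eta> * t - (\<Sum>\<^sub>\<infinity>s\<in>{0<..t}. ln (1 + \<omega>\<^sub>1 * exp \<eta> * (jump (\<lambda>u. L u \<omega>) s)\<^sup>2))"

definition cogarch_sigma_sq ::
  "(real \<Rightarrow> 'a \<Rightarrow> real) \<Rightarrow> real \<Rightarrow> real \<Rightarrow> real \<Rightarrow> ('a \<Rightarrow> real) \<Rightarrow> real \<Rightarrow> 'a \<Rightarrow> real" where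
  "cogarch_sigma_sq L \<omega>\<^sub>0 \<omega>\<^sub>1 \<eta> s0 t \<omega> =
     (s0 \<omega> + \<omega>\<^sub>0 * (LINT s:{0..t}|lborel. exp (cogarch_X L \<omega>\<^sub>1 \<eta> s \<omega>)))
       * exp (- left_limit (\<lambda>s. cogarch_X L \<omega>\<^sub>1 \<eta> s \<omega>) t)"

end

theory Submission
  imports Defs
begin

text \<open>
  Everything is pathwise. The driver \<open>D = [L,L]\<^sup>(\<^sup>d\<^sup>)\<close> is a sum of nonnegative jumps, so the integral of a
  simple process against it is the sum of its values times the jumps, and passing to the limit along an
  almost surely convergent subsequence identifies the integral in the equation for \<open>Y\<close> as
  \<open>\<Sum> V\<^sub>s \<Delta>D\<^sub>s\<close>. Hence \<open>W = \<alpha>\<^sub>0 + \<alpha>\<^sub>1 Y\<close> solves a linear equation driven by time and \<open>D\<close>. The function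
  \<open>W exp(X) - \<alpha>\<^sub>0 \<beta>\<^sub>1 \<integral> exp(X)\<close> has growth rate zero relative to the strictly increasing function
  \<open>t + D\<^sub>t\<close>, so it is constant; taking left limits gives the formula for \<open>V\<close>. The integral
  defining \<open>G\<close> does not change when its integrand is replaced by an indistinguishable one.
\<close>

section \<open>Sums of nonnegative jumps\<close>

text \<open>A Stieltjes product rule for \<open>W\<close> and \<open>exp X\<close> would have to
  cope with jump times that may be dense. Estimates at one point x at a time avoid it: up to o(A t -
  A x), where A = t + D, the increments are dW = (c - b W) dt + a W dD and d exp(X) = exp(X) (b dt -
  a dD), so dD cancels in the product and c exp(X) dt remains. The logarithm in X adds only an error
  quadratic in the increment of D, negligible as long as D tends to D x from the side considered.
  This fails only to the left of a jump time. There A grows by at least the jump, so left continuity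
  of the product suffices; it holds because the jump multiplies W by 1 + a j and divides exp(X) by
  the same factor. Two default values also shape the proof: \<open>infsum\<close> is 0 on a
  nonsummable family, and \<open>measure\<close> is 0 on a nonmeasurable set. Cadlag paths of D
  therefore do not by themselves give summable squared jumps, and ucp convergence says something
  about paths only once the events in it are known to be measurable.\<close>

lemma infsum_split_real:
  fixes f :: "'b \<Rightarrow> real"
  assumes "f summable_on A" "B \<subseteq> A"
  shows "infsum f A = infsum f B + infsum f (A - B)"
proof -
  have "infsum f (B \<union> (A - B)) = infsum f B + infsum f (A - B)"
    by (intro infsum_Un_disjoint summable_on_subset_banach[OF assms(1)]) (use assms in auto)
  moreover have "B \<union> (A - B) = A" using assms by auto
  ultimately show ?thesis by simp
qed

text \<open>The differences \<open>(v s - w s) * j s\<close> are dominated by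
  \<open>\<delta> * j s\<close>. This carries uniform closeness of integrands over to integrals
  against D; \<open>w = 0\<close> gives summability for bounded integrands.\<close>

lemma infsum_bound_diff:
  fixes j v :: "'b \<Rightarrow> real"
  assumes j: "\<And>s. s \<in> A \<Longrightarrow> 0 \<le> j s" "j summable_on A"
    and v: "\<And>s. s \<in> A \<Longrightarrow> \<bar>v s - w s\<bar> \<le> \<delta>"
    and w: "(\<lambda>s. w s * j s) summable_on A"
  shows "(\<lambda>s. v s * j s) summable_on A"
    and "\<bar>infsum (\<lambda>s. v s * j s) A - infsum (\<lambda>s. w s * j s) A\<bar> \<le> \<delta> * infsum j A"
proof -
  have le: "norm ((v s - w s) * j s) \<le> \<delta> * j s" if "s \<in> A" for s
    using j(1)[OF that] v[OF that] by (auto simp: abs_mult intro: mult_right_mono)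
  have dj: "(\<lambda>s. \<delta> * j s) summable_on A" by (intro summable_on_cmult_right j)
  have "(\<lambda>s. norm ((v s - w s) * j s)) summable_on A"
    using summable_on_comparison_test[OF dj le] by simp
  then have s1: "(\<lambda>s. (v s - w s) * j s) summable_on A" by (rule abs_summable_summable)
  have eq: "(\<lambda>s. v s * j s) = (\<lambda>s. w s * j s + (v s - w s) * j s)" by (auto simp: algebra_simps)
  show "(\<lambda>s. v s * j s) summable_on A" unfolding eq by (intro summable_on_add w s1)
  have "infsum (\<lambda>s. v s * j s) A - infsum (\<lambda>s. w s * j s) A = infsum (\<lambda>s. (v s - w s) * j s) A"
    unfolding eq by (subst infsum_add[OF w s1]) simp
  moreover have "norm (infsum (\<lambda>s. (v s - w s) * j s) A) \<le> infsum (\<lambda>s. \<delta> * j s) A"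
    by (rule norm_infsum_le[OF has_sum_infsum has_sum_infsum]) (use s1 dj le in auto)
  ultimately show "\<bar>infsum (\<lambda>s. v s * j s) A - infsum (\<lambda>s. w s * j s) A\<bar> \<le> \<delta> * infsum j A"
    by (simp add: infsum_cmult_right')
qed

text \<open>Kept apart from the squared jumps of a Levy path because it is used twice: for the jumps
  of D and for the jumps \<open>ln (1 + a * j s)\<close> that are subtracted in X.\<close>

locale jump_path =
  fixes j :: "real \<Rightarrow> real"
  assumes nonneg: "0 \<le> j s"
    and summable: "j summable_on {0<..t}"
begin

definition D :: "real \<Rightarrow> real" where "D t = infsum j {0<..t}"

lemma summable_on_bounded: "A \<subseteq> {0<..t} \<Longrightarrow> j summable_on A"
  using summable summable_on_subset_banach by blast

lemma D_diff: "0 \<le> s \<Longrightarrow> s \<le> t \<Longrightarrow> D t - D s = infsum j {s<..t}"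
  unfolding D_def
  by (subst infsum_split_real[OF summable, of "{0<..s}" t]) (auto intro!: infsum_cong arg_cong[of _ _ "infsum j"])

lemma D_mono: "s \<le> t \<Longrightarrow> D s \<le> D t"
  unfolding D_def by (intro infsum_mono2 summable) (auto simp: nonneg)

lemma jump_le_D_diff: "0 \<le> s \<Longrightarrow> s < u \<Longrightarrow> u \<le> t \<Longrightarrow> j u \<le> D t - D s"
  using infsum_mono2[of j "{u}" "{s<..t}"] summable_on_bounded[of "{s<..t}" t]
  by (auto simp: D_diff nonneg subset_iff)

text \<open>A finite set S carries all but e/2 of the mass on (0, x + 1], and a small enough
  neighbourhood of x contains no point of S other than x. The point x is excluded because it may
  carry a jump of its own. Both one-sided limits of \<open>D\<close> follow.\<close>

lemma sum_near_small:
  assumes "0 < e"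
  obtains d where "0 < d" "d \<le> 1"
    "\<And>B. B \<subseteq> {0<..} \<inter> {x - d<..<x + d} - {x} \<Longrightarrow> infsum j B < e"
proof -
  let ?A = "{0<..x + 1}"
  obtain S where S: "finite S" "S \<subseteq> ?A" "dist (sum j S) (infsum j ?A) \<le> e / 2"
    using infsum_finite_approximation[OF summable[of "x+1"], of "e/2"] assms by auto
  obtain d where d: "d > 0" "\<forall>y\<in>S. y \<noteq> x \<longrightarrow> d \<le> dist x y"
    using finite_set_avoid[OF S(1)] by blast
  show ?thesis
  proof (rule that[of "min 1 d"])
    fix B assume B: "B \<subseteq> {0<..} \<inter> {x - min 1 d<..<x + min 1 d} - {x}"
    have BA: "B \<subseteq> ?A" using B by (force simp: subset_iff)
    have "B \<inter> S = {}" using B d(2) by (fastforce simp: dist_real_def)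
    then have "infsum j (S \<union> B) = sum j S + infsum j B"
      by (subst infsum_Un_disjoint) (use S summable_on_bounded[OF BA] in auto)
    moreover have "infsum j (S \<union> B) \<le> infsum j ?A"
      by (intro infsum_mono2 summable_on_bounded[of _ "x + 1"]) (use S BA nonneg in auto)
    ultimately show "infsum j B < e" using S(3) assms unfolding dist_real_def by linarith
  qed (use d in auto)
qed

lemma D_right: "0 \<le> x \<Longrightarrow> (D \<longlongrightarrow> D x) (at_right x)"
proof (rule tendstoI)
  fix e :: real assume x: "0 \<le> x" and "0 < e"
  then obtain d where d: "0 < d" "\<And>B. B \<subseteq> {0<..} \<inter> {x - d<..<x + d} - {x} \<Longrightarrow> infsum j B < e"
    using sum_near_small by metis
  have "dist (D t) (D x) < e" if "x < t" "t < x + d" for t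
    using D_diff[OF x, of t] D_mono[of x t] d(2)[of "{x<..t}"] x that
    by (auto simp: dist_real_def subset_iff)
  then show "\<forall>\<^sub>F t in at_right x. dist (D t) (D x) < e"
    using d(1) by (auto simp: eventually_at_right_field intro!: exI[of _ "x + d"])
qed

lemma D_left: "0 < x \<Longrightarrow> (D \<longlongrightarrow> D x - j x) (at_left x)"
proof (rule tendstoI)
  fix e :: real assume x: "0 < x" and "0 < e"
  then obtain d where d: "0 < d" "\<And>B. B \<subseteq> {0<..} \<inter> {x - d<..<x + d} - {x} \<Longrightarrow> infsum j B < e"
    using sum_near_small by metis
  have "dist (D t) (D x - j x) < e" if "max 0 (x - d) < t" "t < x" for t
  proof -
    have "D x - D t = j x + infsum j ({t<..x} - {x})"
      using that infsum_split_real[of j "{t<..x}" "{x}"]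
      by (simp add: D_diff summable_on_bounded[of _ x] subset_iff)
    moreover have "0 \<le> infsum j ({t<..x} - {x})" by (intro infsum_nonneg nonneg)
    moreover have "infsum j ({t<..x} - {x}) < e" using that by (intro d) auto
    ultimately show ?thesis by (auto simp: dist_real_def)
  qed
  then show "\<forall>\<^sub>F t in at_left x. dist (D t) (D x - j x) < e"
    using d(1) x by (auto simp: eventually_at_left_field intro!: exI[of _ "max 0 (x - d)"])
qed

lemma ln_jump_path:
  assumes "0 \<le> a" shows "jump_path (\<lambda>s. ln (1 + a * j s))"
proof
  show "0 \<le> ln (1 + a * j s)" for s using assms nonneg[of s] by simp
  show "(\<lambda>s. ln (1 + a * j s)) summable_on {0<..t}" for t
    by (rule summable_on_comparison_test[OF summable_on_cmult_right[OF summable, of a]])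
       (use assms nonneg ln_add_one_self_le_self in auto)
qed

end

section \<open>Constancy from increments that are negligible relative to a clock\<close>

text \<open>For fixed \<epsilon> the bound by \<epsilon> times the increment of \<open>A\<close>
  holds on short intervals around each point and survives concatenation, so bisection extends it to
  [0, T]; then \<epsilon> tends to 0. Both hypotheses are anchored at x itself, so
  \<open>\<phi>\<close> and \<open>A\<close> may jump.\<close>

lemma zero_increment_rate_imp_constant:
  fixes \<phi> A :: "real \<Rightarrow> real"
  assumes T: "0 \<le> T"
    and right: "\<And>x \<epsilon>. 0 \<le> x \<Longrightarrow> 0 < \<epsilon> \<Longrightarrow> \<forall>\<^sub>F t in at_right x. \<bar>\<phi> t - \<phi> x\<bar> \<le> \<epsilon> * (A t - A x)"
    and left: "\<And>x \<epsilon>. 0 < x \<Longrightarrow> 0 < \<epsilon> \<Longrightarrow> \<forall>\<^sub>F t in at_left x. \<bar>\<phi> x - \<phi> t\<bar> \<le> \<epsilon> * (A x - A t)"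
  shows "\<phi> T = \<phi> 0"
proof -
  have small: "\<bar>\<phi> T - \<phi> 0\<bar> \<le> \<epsilon> * (A T - A 0)" if \<epsilon>: "0 < \<epsilon>" for \<epsilon>
  proof -
    \<comment> \<open>Bisection also produces intervals around 0 that start at negative times; the
      guard makes the claim trivial there.\<close>
    define P where "P a b \<longleftrightarrow> (0 \<le> a \<longrightarrow> \<bar>\<phi> b - \<phi> a\<bar> \<le> \<epsilon> * (A b - A a))" for a b
    have "P 0 T"
    using T
    proof (induction rule: Bolzano)
      case (trans a b c) then show ?case unfolding P_def by (auto simp: algebra_simps)
    next
      case (local x)
      obtain r where r: "r > x" "\<And>t. x < t \<Longrightarrow> t < r \<Longrightarrow> \<bar>\<phi> t - \<phi> x\<bar> \<le> \<epsilon> * (A t - A x)"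
        using right[OF local(1) \<epsilon>] by (auto simp: eventually_at_right_field)
      obtain l where l: "l < x" "\<And>t. l < t \<Longrightarrow> t < x \<Longrightarrow> 0 \<le> t \<Longrightarrow> \<bar>\<phi> x - \<phi> t\<bar> \<le> \<epsilon> * (A x - A t)"
      proof (cases "x = 0")
        case True then show ?thesis using that[of "-1"] by auto
      next
        case False
        then show ?thesis using left[of x, OF _ \<epsilon>] local that by (auto simp: eventually_at_left_field)
      qed
      have "P a b" if "a \<le> x" "x \<le> b" "b - a < min (r - x) (x - l)" for a b
      proof -
        have "0 \<le> a \<Longrightarrow> \<bar>\<phi> x - \<phi> a\<bar> \<le> \<epsilon> * (A x - A a)" using l(2)[of a] that by (cases "a = x") auto
        moreover have "\<bar>\<phi> b - \<phi> x\<bar> \<le> \<epsilon> * (A b - A x)" using r(2)[of b] that by (cases "b = x") auto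
        ultimately show ?thesis unfolding P_def by (auto simp: algebra_simps)
      qed
      then show ?case using r l by (intro exI[of _ "min (r - x) (x - l)"]) auto
    qed
    then show ?thesis unfolding P_def by simp
  qed
  have "\<bar>\<phi> T - \<phi> 0\<bar> \<le> 0"
  proof (rule tendsto_lowerbound[of "\<lambda>\<epsilon>. \<epsilon> * (A T - A 0)" _ "at_right 0"])
    show "((\<lambda>\<epsilon>. \<epsilon> * (A T - A 0)) \<longlongrightarrow> 0) (at_right 0)" by (auto intro!: tendsto_eq_intros)
    show "\<forall>\<^sub>F \<epsilon> in at_right 0. \<bar>\<phi> T - \<phi> 0\<bar> \<le> \<epsilon> * (A T - A 0)"
      using small by (auto simp: eventually_at_right_field intro!: exI[of _ 1])
  qed simp
  then show ?thesis by simp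
qed

text \<open>The bound is asked only on the open interval: at the left endpoint of an increment, v is
  a left limit and may be far from the nearby values.\<close>

lemma integral_near_const:
  fixes f :: "real \<Rightarrow> real"
  assumes f: "f integrable_on {0..t}" and st: "0 \<le> s" "s \<le> t"
    and b: "\<And>u. s < u \<Longrightarrow> u < t \<Longrightarrow> \<bar>f u - c\<bar> \<le> \<delta>"
  shows "\<bar>integral {0..t} f - integral {0..s} f - c * (t - s)\<bar> \<le> \<delta> * (t - s)"
proof -
  have i: "f integrable_on {s..t}" using integrable_on_subinterval[OF f] st by auto
  then have i': "f integrable_on {s<..<t}" by (simp add: integrable_on_Icc_iff_Ioo)
  have c': "(\<lambda>_. k) integrable_on {s<..<t}" for k :: real
    using integrable_const_ivl integrable_on_Icc_iff_Ioo by blast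
  have "integral {0..t} f - integral {0..s} f = integral {s<..<t} f"
    using Henstock_Kurzweil_Integration.integral_combine[OF st f] by (simp add: integral_open_interval_real)
  moreover have "integral {s<..<t} f \<le> integral {s<..<t} (\<lambda>_. c + \<delta>)"
    by (rule integral_le[OF i' c']) (use b in \<open>force simp: abs_le_iff\<close>)
  moreover have "integral {s<..<t} (\<lambda>_. c - \<delta>) \<le> integral {s<..<t} f"
    by (rule integral_le[OF c' i']) (use b in \<open>force simp: abs_le_iff\<close>)
  moreover have "integral {s<..<t} (\<lambda>_. k) = k * (t - s)" for k :: real
    using st by (simp flip: integral_open_interval_real)
  ultimately show ?thesis by (auto simp: abs_le_iff algebra_simps)
qed

section \<open>The linear equation driven by a jump path\<close>

text \<open>Here W is \<open>\<alpha>\<^sub>0 + \<alpha>\<^sub>1 Y\<close> on one path, v its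
  process of left limits (the volatility), a and b are \<open>\<alpha>\<^sub>1\<close> and
  \<open>\<beta>\<^sub>1\<close>, and c is \<open>\<alpha>\<^sub>0 * \<beta>\<^sub>1\<close>, the
  constant \<open>\<omega>\<^sub>0\<close>.\<close>

locale cogarch_path = jump_path +
  fixes W v :: "real \<Rightarrow> real" and a b c :: real
  assumes a: "0 \<le> a" and b: "0 \<le> b"
    and W_right: "0 \<le> x \<Longrightarrow> (W \<longlongrightarrow> W x) (at_right x)"
    and W_left: "0 < x \<Longrightarrow> (W \<longlongrightarrow> v x) (at_left x)"
    and v_bounded: "\<exists>B. \<forall>u\<in>{0<..t}. \<bar>v u\<bar> \<le> B"
    and v_integrable: "v integrable_on {0..t}"
    and W_eq: "0 \<le> t \<Longrightarrow>
      W t = W 0 + integral {0..t} (\<lambda>u. c - b * v u) + a * infsum (\<lambda>u. v u * j u) {0<..t}"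
begin

sublocale L: jump_path "\<lambda>s. ln (1 + a * j s)"
  by (rule ln_jump_path[OF a])

text \<open>The clock against which all rates are measured. It dominates the increments of time and
  of D, and the summand t keeps it strictly increasing where D is flat.\<close>

definition A :: "real \<Rightarrow> real" where "A t = t + D t"
definition X :: "real \<Rightarrow> real" where "X t = b * t - L.D t"
definition I :: "real \<Rightarrow> real" where "I t = integral {0..t} (\<lambda>u. exp (X u))"

lemma A_mono: "s \<le> t \<Longrightarrow> t - s \<le> A t - A s" "s \<le> t \<Longrightarrow> D t - D s \<le> A t - A s"
  using D_mono[of s t] by (auto simp: A_def)

text \<open>Each \<open>v u\<close> is a limit of values of W from the left of u, all inside (l, r).
  The right endpoint r is therefore included, which matters when r is the point x approached from
  the left.\<close>

lemma v_near:
  assumes "0 \<le> l" and W: "\<And>u. l < u \<Longrightarrow> u < r \<Longrightarrow> \<bar>W u - w\<bar> \<le> e" and u: "l < u" "u \<le> r"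
  shows "\<bar>v u - w\<bar> \<le> e"
proof (rule tendsto_upperbound)
  show "((\<lambda>s. \<bar>W s - w\<bar>) \<longlongrightarrow> \<bar>v u - w\<bar>) (at_left u)"
    using assms by (intro tendsto_intros W_left) auto
  show "\<forall>\<^sub>F s in at_left u. \<bar>W s - w\<bar> \<le> e"
    using assms by (auto simp: eventually_at_left_field intro!: exI[of _ l])
qed simp

lemma weighted_summable: "(\<lambda>u. v u * j u) summable_on {0<..t}"
proof -
  obtain B where B: "\<forall>u\<in>{0<..t}. \<bar>v u\<bar> \<le> B" using v_bounded by blast
  show ?thesis
    by (rule infsum_bound_diff(1)[where w = "\<lambda>_. 0" and \<delta> = B, OF nonneg summable]) (use B in auto)
qed

text \<open>Freezing v at w in the integral equation costs at most \<delta> per unit of time and of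
  D, with factors b and a. The value to freeze depends on the side: \<open>W x\<close> to the right
  of x, \<open>v x\<close> to the left.\<close>

lemma W_increment:
  assumes st: "0 \<le> s" "s \<le> t" and v: "\<And>u. s < u \<Longrightarrow> u \<le> t \<Longrightarrow> \<bar>v u - w\<bar> \<le> \<delta>" and \<delta>: "0 \<le> \<delta>"
  shows "\<bar>W t - W s - (c - b * w) * (t - s) - a * w * (D t - D s)\<bar> \<le> \<delta> * (a + b) * (A t - A s)"
proof -
  let ?i = "integral {0..t} (\<lambda>u. c - b * v u) - integral {0..s} (\<lambda>u. c - b * v u)"
  have "(\<lambda>u. c - b * v u) integrable_on {0..t}"
    by (intro integrable_diff integrable_on_mult_right v_integrable integrable_const_ivl)
  then have i: "\<bar>?i - (c - b * w) * (t - s)\<bar> \<le> (b * \<delta>) * (t - s)"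
  proof (rule integral_near_const[OF _ st])
    fix u assume "s < u" "u < t"
    then have "b * \<bar>v u - w\<bar> \<le> b * \<delta>" using v b by (intro mult_left_mono) auto
    moreover have "c - b * v u - (c - b * w) = - (b * (v u - w))" by (simp add: algebra_simps)
    ultimately show "\<bar>c - b * v u - (c - b * w)\<bar> \<le> b * \<delta>"
      using b by (simp add: abs_mult)
  qed
  have eq: "{0<..t} - {0<..s} = {s<..t}" using st by auto
  have sm: "infsum (\<lambda>u. v u * j u) {0<..t} - infsum (\<lambda>u. v u * j u) {0<..s} = infsum (\<lambda>u. v u * j u) {s<..t}"
    using infsum_split_real[OF weighted_summable, of "{0<..s}" t] st by (simp add: eq subset_iff)
  have jst: "j summable_on {s<..t}" by (rule summable_on_bounded[of _ t]) (use st in auto)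
  have "\<bar>infsum (\<lambda>u. v u * j u) {s<..t} - infsum (\<lambda>u. w * j u) {s<..t}\<bar> \<le> \<delta> * infsum j {s<..t}"
    by (rule infsum_bound_diff(2)[OF _ jst _ summable_on_cmult_right[OF jst]]) (use v nonneg in auto)
  then have "a * \<bar>infsum (\<lambda>u. v u * j u) {s<..t} - w * (D t - D s)\<bar> \<le> a * (\<delta> * (D t - D s))"
    using st a by (intro mult_left_mono) (auto simp: D_diff infsum_cmult_right')
  then have j: "\<bar>a * infsum (\<lambda>u. v u * j u) {s<..t} - a * w * (D t - D s)\<bar> \<le> \<delta> * a * (D t - D s)"
    using a by (simp add: abs_mult_pos' right_diff_distrib mult.assoc mult.left_commute)
  have "W t - W s = ?i + a * infsum (\<lambda>u. v u * j u) {s<..t}"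
    using W_eq[of t] W_eq[of s] st by (simp add: right_diff_distrib flip: sm)
  then have "\<bar>W t - W s - (c - b * w) * (t - s) - a * w * (D t - D s)\<bar>
      \<le> (\<delta> * b) * (t - s) + (\<delta> * a) * (D t - D s)"
    using i j by (simp add: mult.commute[of \<delta> b])
  also have "\<dots> \<le> (\<delta> * b) * (A t - A s) + (\<delta> * a) * (A t - A s)"
    using a b \<delta> A_mono[OF st(2)] by (intro add_mono mult_left_mono) auto
  finally show ?thesis by (simp add: algebra_simps)
qed

text \<open>Each jump contributes the error y - ln (1 + y), between 0 and y squared, with y = a j u.
  As y is at most d = a (D t - D s), the errors sum to at most d times the sum of all y, which is d
  squared.\<close>

lemma X_increment:
  assumes st: "0 \<le> s" "s \<le> t"
  shows "\<bar>X t - X s - (b * (t - s) - a * (D t - D s))\<bar> \<le> (a * (D t - D s))\<^sup>2"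
proof -
  let ?d = "a * (D t - D s)" and ?B = "{s<..t}"
  have jst: "j summable_on ?B" by (rule summable_on_bounded[of _ t]) (use st in auto)
  have lst: "(\<lambda>s. ln (1 + a * j s)) summable_on ?B"
    by (rule L.summable_on_bounded[of _ t]) (use st in auto)
  have d: "?d = infsum (\<lambda>s. a * j s) ?B" using st by (simp add: D_diff infsum_cmult_right')
  have pt: "0 \<le> a * j u - ln (1 + a * j u) \<and> a * j u - ln (1 + a * j u) \<le> ?d * (a * j u)" if "u \<in> ?B" for u
  proof -
    have x: "0 \<le> a * j u" "a * j u \<le> ?d"
      using mult_nonneg_nonneg[OF a nonneg] mult_left_mono[OF jump_le_D_diff[of s u t] a] that st by auto
    have "a * j u - ln (1 + a * j u) \<le> (a * j u)\<^sup>2"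
    proof (cases "a * j u \<le> 1")
      case True then show ?thesis using ln_one_plus_pos_lower_bound[of "a * j u"] x by simp
    next
      case False
      then have "a * j u \<le> (a * j u)\<^sup>2"
        using mult_left_mono[of 1 "a * j u" "a * j u"] x(1) by (simp add: power2_eq_square)
      moreover have "0 \<le> ln (1 + a * j u)" using x(1) by simp
      ultimately show ?thesis by linarith
    qed
    also have "\<dots> \<le> ?d * (a * j u)" unfolding power2_eq_square by (rule mult_right_mono[OF x(2,1)])
    finally show ?thesis using ln_add_one_self_le_self[OF x(1)] by simp
  qed
  have s1: "(\<lambda>u. a * j u) summable_on ?B" by (intro summable_on_cmult_right jst)
  have le: "0 \<le> ln (1 + a * j u)" for u using a nonneg by simp
  have s2: "(\<lambda>u. a * j u - ln (1 + a * j u)) summable_on ?B"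
  proof (rule summable_on_comparison_test[OF s1])
    show "a * j u - ln (1 + a * j u) \<le> a * j u" for u using le[of u] by linarith
    show "0 \<le> a * j u - ln (1 + a * j u)" if "u \<in> ?B" for u using pt[OF that] by (rule conjunct1)
  qed
  have "infsum (\<lambda>u. a * j u) ?B = infsum (\<lambda>u. ln (1 + a * j u)) ?B + infsum (\<lambda>u. a * j u - ln (1 + a * j u)) ?B"
    using infsum_add[OF lst s2] by simp
  then have eq: "?d - (L.D t - L.D s) = infsum (\<lambda>u. a * j u - ln (1 + a * j u)) ?B"
    using d L.D_diff[OF st] by linarith
  have "0 \<le> infsum (\<lambda>u. a * j u - ln (1 + a * j u)) ?B"
    by (rule infsum_nonneg) (rule pt[THEN conjunct1])
  moreover have "infsum (\<lambda>u. a * j u - ln (1 + a * j u)) ?B \<le> infsum (\<lambda>u. ?d * (a * j u)) ?B"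
    by (rule infsum_mono[OF s2 summable_on_cmult_right[OF s1]]) (rule pt[THEN conjunct2])
  moreover have "\<dots> = ?d\<^sup>2"
    using infsum_cmult_right'[of ?d "\<lambda>u. a * j u" ?B] d by (simp only: power2_eq_square)
  moreover have "X t - X s - (b * (t - s) - ?d) = ?d - (L.D t - L.D s)"
    by (simp add: X_def right_diff_distrib)
  ultimately show ?thesis using eq by linarith
qed


text \<open>A general filter covers both sides of x. Convergence of D to \<open>D x\<close> is what
  makes the quadratic error negligible, and it excludes the left side of a jump time.\<close>

lemma X_rate:
  assumes "0 \<le> x" "(D \<longlongrightarrow> D x) F" "\<forall>\<^sub>F t in F. 0 \<le> t"
  shows "(\<lambda>t. X t - X x - (b * (t - x) - a * (D t - D x))) \<in> o[F](\<lambda>t. A t - A x)"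
proof (rule landau_o.smallI)
  fix e :: real assume e: "0 < e"
  have "((\<lambda>t. a\<^sup>2 * \<bar>D t - D x\<bar>) \<longlongrightarrow> a\<^sup>2 * \<bar>D x - D x\<bar>) F"
    by (intro tendsto_intros assms)
  then have "\<forall>\<^sub>F t in F. a\<^sup>2 * \<bar>D t - D x\<bar> < e"
    using e by (auto dest: order_tendstoD(2))
  with assms(3) show "\<forall>\<^sub>F t in F. norm (X t - X x - (b * (t - x) - a * (D t - D x))) \<le> e * norm (A t - A x)"
  proof eventually_elim
    case (elim t)
    have "norm (X t - X x - (b * (t - x) - a * (D t - D x))) \<le> (a * (D t - D x))\<^sup>2"
    proof (cases "x \<le> t")
      case True then show ?thesis using X_increment[OF assms(1) True] by simp
    next
      case False
      then have "\<bar>X x - X t - (b * (x - t) - a * (D x - D t))\<bar> \<le> (a * (D x - D t))\<^sup>2"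
        using X_increment[of t x] elim by simp
      moreover have "X t - X x - (b * (t - x) - a * (D t - D x)) = - (X x - X t - (b * (x - t) - a * (D x - D t)))"
        by (simp add: algebra_simps)
      moreover have "(a * (D t - D x))\<^sup>2 = (a * (D x - D t))\<^sup>2"
        by (simp add: power_mult_distrib power2_commute)
      ultimately show ?thesis by (metis abs_minus_cancel real_norm_def)
    qed
    also have "\<dots> = a\<^sup>2 * \<bar>D t - D x\<bar> * \<bar>D t - D x\<bar>"
      by (simp add: power_mult_distrib power2_eq_square)
    also have "\<dots> \<le> e * \<bar>A t - A x\<bar>"
    proof (rule mult_mono)
      show "\<bar>D t - D x\<bar> \<le> \<bar>A t - A x\<bar>"
        using A_mono(2)[of x t] A_mono(2)[of t x] D_mono[of x t] D_mono[of t x] by linarith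
    qed (use elim e in auto)
    finally show ?case by simp
  qed
qed

lemma W_right_rate:
  assumes x: "0 \<le> x"
  shows "(\<lambda>t. W t - W x - (c - b * W x) * (t - x) - a * W x * (D t - D x)) \<in> o[at_right x](\<lambda>t. A t - A x)"
proof (rule landau_o.smallI)
  fix e :: real assume e: "0 < e"
  \<comment> \<open>The 1 keeps the denominator positive when a and b are both 0.\<close>
  define \<delta> where "\<delta> = e / (a + b + 1)"
  have \<delta>: "0 < \<delta>" "\<delta> * (a + b) \<le> e" using e a b by (auto simp: \<delta>_def field_simps)
  obtain r where r: "x < r" "\<And>t. x < t \<Longrightarrow> t < r \<Longrightarrow> \<bar>W t - W x\<bar> < \<delta>"
    using tendstoD[OF W_right[OF x] \<delta>(1)] by (auto simp: eventually_at_right_field dist_real_def)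
  have v: "\<bar>v u - W x\<bar> \<le> \<delta>" if "x < u" "u < r" for u
    by (rule v_near[OF x, of r]) (use r that in \<open>auto intro: less_imp_le\<close>)
  have "norm (W t - W x - (c - b * W x) * (t - x) - a * W x * (D t - D x)) \<le> e * norm (A t - A x)"
    if t: "x < t" "t < r" for t
  proof -
    have "\<bar>W t - W x - (c - b * W x) * (t - x) - a * W x * (D t - D x)\<bar> \<le> \<delta> * (a + b) * (A t - A x)"
      by (rule W_increment) (use x t v \<delta> in auto)
    also have "\<dots> \<le> e * (A t - A x)" using \<delta> t A_mono(1)[of x t] by (intro mult_right_mono) auto
    also have "\<dots> = e * norm (A t - A x)" using t A_mono(1)[of x t] by simp
    finally show ?thesis by simp
  qed
  then show "\<forall>\<^sub>F t in at_right x. norm (W t - W x - (c - b * W x) * (t - x) - a * W x * (D t - D x)) \<le> e * norm (A t - A x)"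
    using r(1) unfolding eventually_at_right_field by blast
qed

text \<open>Unlike \<open>X_rate\<close> this also holds at a jump time: with the left limit
  \<open>v x\<close> frozen, v is close to it up to and including x, so the jump of W at x is
  accounted for exactly.\<close>

lemma W_left_rate:
  assumes x: "0 < x"
  shows "(\<lambda>t. W t - W x - (c - b * v x) * (t - x) - a * v x * (D t - D x)) \<in> o[at_left x](\<lambda>t. A t - A x)"
proof (rule landau_o.smallI)
  fix e :: real assume e: "0 < e"
  define \<delta> where "\<delta> = e / (a + b + 1)"
  have \<delta>: "0 < \<delta>" "\<delta> * (a + b) \<le> e" using e a b by (auto simp: \<delta>_def field_simps)
  obtain l where "l < x" "\<And>t. l < t \<Longrightarrow> t < x \<Longrightarrow> \<bar>W t - v x\<bar> < \<delta>"
    using tendstoD[OF W_left[OF x] \<delta>(1)] by (auto simp: eventually_at_left_field dist_real_def)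
  then obtain l where l: "0 \<le> l" "l < x" "\<And>t. l < t \<Longrightarrow> t < x \<Longrightarrow> \<bar>W t - v x\<bar> < \<delta>"
    using x that[of "max 0 l"] by auto
  have v: "\<bar>v u - v x\<bar> \<le> \<delta>" if "l < u" "u \<le> x" for u
    by (rule v_near[of l x]) (use l that in \<open>auto intro: less_imp_le\<close>)
  have "norm (W t - W x - (c - b * v x) * (t - x) - a * v x * (D t - D x)) \<le> e * norm (A t - A x)"
    if t: "l < t" "t < x" for t
  proof -
    have "\<bar>W x - W t - (c - b * v x) * (x - t) - a * v x * (D x - D t)\<bar> \<le> \<delta> * (a + b) * (A x - A t)"
      by (rule W_increment) (use l t v \<delta> in auto)
    also have "\<dots> \<le> e * (A x - A t)" using \<delta> t A_mono(1)[of t x] by (intro mult_right_mono) auto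
    also have "\<dots> = e * norm (A t - A x)" using t A_mono(1)[of t x] by simp
    also have "W x - W t - (c - b * v x) * (x - t) - a * v x * (D x - D t)
        = - (W t - W x - (c - b * v x) * (t - x) - a * v x * (D t - D x))" by (simp add: algebra_simps)
    finally show ?thesis by simp
  qed
  then show "\<forall>\<^sub>F t in at_left x. norm (W t - W x - (c - b * v x) * (t - x) - a * v x * (D t - D x)) \<le> e * norm (A t - A x)"
    using l(2) unfolding eventually_at_left_field by blast
qed

end

section \<open>Rates of the time integral and of the product\<close>

lemma set_integrable_bounded_Icc:
  fixes f :: "real \<Rightarrow> real"
  assumes "f \<in> borel_measurable borel" "\<And>u. u \<in> {s..t} \<Longrightarrow> \<bar>f u\<bar> \<le> B"
  shows "set_integrable lborel {s..t} f"
  unfolding set_integrable_def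
  by (rule integrableI_bounded_set_indicator[where B = B]) (use assms in \<open>auto simp: emeasure_lborel_Icc_eq\<close>)

context cogarch_path
begin

lemma exp_X_set_integrable: "set_integrable lborel {0..t} (\<lambda>u. exp (X u))"
proof (rule set_integrable_bounded_Icc)
  have "mono L.D" by (intro monoI L.D_mono)
  then have [measurable]: "L.D \<in> borel_measurable borel" by (rule borel_measurable_mono)
  show "(\<lambda>u. exp (X u)) \<in> borel_measurable borel" unfolding X_def by measurable
  show "\<bar>exp (X u)\<bar> \<le> exp (b * t)" if "u \<in> {0..t}" for u
  proof -
    have "0 \<le> L.D u" unfolding L.D_def by (intro infsum_nonneg L.nonneg)
    moreover have "b * u \<le> b * t" using that b by (intro mult_left_mono) auto
    ultimately show ?thesis by (simp add: X_def)
  qed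
qed

lemma exp_X_integrable: "(\<lambda>u. exp (X u)) integrable_on {0..t}"
  using set_borel_integral_eq_integral(1)[OF exp_X_set_integrable] .

lemma I_right_rate:
  assumes x: "0 \<le> x" and X: "(X \<longlongrightarrow> X x) (at_right x)"
  shows "(\<lambda>t. I t - I x - exp (X x) * (t - x)) \<in> o[at_right x](\<lambda>t. A t - A x)"
proof (rule landau_o.smallI)
  fix e :: real assume e: "0 < e"
  obtain r where r: "x < r" "\<And>t. x < t \<Longrightarrow> t < r \<Longrightarrow> \<bar>exp (X t) - exp (X x)\<bar> < e"
    using tendstoD[OF tendsto_exp[OF X] e] by (auto simp: eventually_at_right_field dist_real_def)
  have "norm (I t - I x - exp (X x) * (t - x)) \<le> e * norm (A t - A x)" if t: "x < t" "t < r" for t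
  proof -
    have "\<bar>I t - I x - exp (X x) * (t - x)\<bar> \<le> e * (t - x)"
      unfolding I_def by (rule integral_near_const[OF exp_X_integrable]) (use x t r in \<open>auto intro: less_imp_le\<close>)
    also have "\<dots> \<le> e * norm (A t - A x)" using t e A_mono(1)[of x t] by (intro mult_left_mono) auto
    finally show ?thesis by simp
  qed
  then show "\<forall>\<^sub>F t in at_right x. norm (I t - I x - exp (X x) * (t - x)) \<le> e * norm (A t - A x)"
    using r(1) unfolding eventually_at_right_field by blast
qed

lemma I_left_rate:
  assumes x: "0 < x" and X: "(X \<longlongrightarrow> X x) (at_left x)"
  shows "(\<lambda>t. I t - I x - exp (X x) * (t - x)) \<in> o[at_left x](\<lambda>t. A t - A x)"
proof (rule landau_o.smallI)
  fix e :: real assume e: "0 < e"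
  obtain l where "l < x" "\<And>t. l < t \<Longrightarrow> t < x \<Longrightarrow> \<bar>exp (X t) - exp (X x)\<bar> < e"
    using tendstoD[OF tendsto_exp[OF X] e] by (auto simp: eventually_at_left_field dist_real_def)
  then obtain l where l: "0 \<le> l" "l < x" "\<And>t. l < t \<Longrightarrow> t < x \<Longrightarrow> \<bar>exp (X t) - exp (X x)\<bar> < e"
    using x that[of "max 0 l"] by auto
  have "norm (I t - I x - exp (X x) * (t - x)) \<le> e * norm (A t - A x)" if t: "l < t" "t < x" for t
  proof -
    have "\<bar>I x - I t - exp (X x) * (x - t)\<bar> \<le> e * (x - t)"
      unfolding I_def by (rule integral_near_const[OF exp_X_integrable]) (use x t l in \<open>auto intro: less_imp_le\<close>)
    also have "\<dots> \<le> e * norm (A t - A x)" using t e A_mono(1)[of t x] by (intro mult_left_mono) auto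
    also have "I x - I t - exp (X x) * (x - t) = - (I t - I x - exp (X x) * (t - x))"
      by (simp add: algebra_simps)
    finally show ?thesis by simp
  qed
  then show "\<forall>\<^sub>F t in at_left x. norm (I t - I x - exp (X x) * (t - x)) \<le> e * norm (A t - A x)"
    using l(2) unfolding eventually_at_left_field by blast
qed

lemma time_bigo: "(\<lambda>t. t - x) \<in> O[F](\<lambda>t. A t - A x)"
  and D_bigo: "(\<lambda>t. D t - D x) \<in> O[F](\<lambda>t. A t - A x)"
proof -
  have "\<bar>t - x\<bar> \<le> \<bar>A t - A x\<bar> \<and> \<bar>D t - D x\<bar> \<le> \<bar>A t - A x\<bar>" for t
    using A_mono[of t x] A_mono[of x t] D_mono[of t x] D_mono[of x t] by linarith
  then show "(\<lambda>t. t - x) \<in> O[F](\<lambda>t. A t - A x)" "(\<lambda>t. D t - D x) \<in> O[F](\<lambda>t. A t - A x)"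
    by (auto intro!: bigoI[where c = 1])
qed

lemma I_left: "0 < x \<Longrightarrow> (I \<longlongrightarrow> I x) (at_left x)"
proof -
  assume x: "0 < x"
  have "continuous_on {0..x} I" unfolding I_def
    by (rule indefinite_integral_continuous_1[OF exp_X_integrable])
  then show "(I \<longlongrightarrow> I x) (at_left x)" using x
    by (auto simp: continuous_on_Icc_at_leftD)
qed

text \<open>
  The product rule for \<open>\<phi> = W exp(X) - c I\<close>: relative to the increasing function \<open>A\<close>,
  the growth rates of \<open>W\<close> and of \<open>exp(X)\<close> cancel up to the rate of \<open>c I\<close>.
\<close>

lemma product_rate:
  assumes W: "(W \<longlongrightarrow> W x) F" and X: "(X \<longlongrightarrow> X x) F"
    and hW: "(\<lambda>t. W t - W x - (c - b * W x) * (t - x) - a * W x * (D t - D x)) \<in> o[F](\<lambda>t. A t - A x)"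
    and hX: "(\<lambda>t. X t - X x - (b * (t - x) - a * (D t - D x))) \<in> o[F](\<lambda>t. A t - A x)"
    and hI: "(\<lambda>t. I t - I x - exp (X x) * (t - x)) \<in> o[F](\<lambda>t. A t - A x)"
  shows "(\<lambda>t. (W t * exp (X t) - c * I t) - (W x * exp (X x) - c * I x)) \<in> o[F](\<lambda>t. A t - A x)"
proof -
  let ?g = "\<lambda>t. A t - A x"
  have "(\<lambda>t. b * (t - x)) \<in> O[F](?g)" using time_bigo by (cases "b = 0") auto
  moreover have "(\<lambda>t. a * (D t - D x)) \<in> O[F](?g)" using D_bigo by (cases "a = 0") auto
  ultimately have lin: "(\<lambda>t. b * (t - x) - a * (D t - D x)) \<in> O[F](?g)" by (rule sum_in_bigo)
  have "(\<lambda>t. (X t - X x - (b * (t - x) - a * (D t - D x))) + (b * (t - x) - a * (D t - D x))) \<in> O[F](?g)"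
    by (intro sum_in_bigo lin landau_o.small_imp_big[OF hX])
  then have dX: "(\<lambda>t. X t - X x) \<in> O[F](?g)" by simp
  \<comment> \<open>Differentiability of exp at \<open>X x\<close>, composed with the convergence of
    X to \<open>X x\<close>; the remainder is small relative to the increment of X, which is O of
    the clock.\<close>
  have R: "(\<lambda>t. exp (X t) - exp (X x) - exp (X x) * (X t - X x)) \<in> o[F](?g)"
  proof (rule landau_o.small_big_trans[OF _ dX], rule landau_o.smallI)
    fix e :: real assume "0 < e"
    moreover have "(exp has_derivative (\<lambda>h. exp (X x) * h)) (at (X x))"
      using DERIV_exp[of "X x"] by (simp add: has_field_derivative_def)
    ultimately obtain d where "0 < d"
      "\<And>y. norm (y - X x) < d \<Longrightarrow> norm (exp y - exp (X x) - exp (X x) * (y - X x)) \<le> e * norm (y - X x)"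
      unfolding has_derivative_at_alt by blast
    then show "\<forall>\<^sub>F t in F. norm (exp (X t) - exp (X x) - exp (X x) * (X t - X x)) \<le> e * norm (X t - X x)"
      using tendstoD[OF X, of d] by (auto simp: dist_norm elim: eventually_mono)
  qed
  have W1: "W \<in> O[F](\<lambda>_. 1)" by (rule bigoI_tendsto[of _ _ "W x"]) (use W in auto)
  have "((\<lambda>t. (W t - W x) / 1) \<longlongrightarrow> 0) F" using W by (auto intro!: tendsto_eq_intros)
  then have W0: "(\<lambda>t. W t - W x) \<in> o[F](\<lambda>_. 1)" by (rule smalloI_tendsto) auto
  have t1: "(\<lambda>t. W t * (exp (X t) - exp (X x) - exp (X x) * (X t - X x))) \<in> o[F](?g)"
    using landau_o.big_small_mult[OF W1 R] by simp
  have t2: "(\<lambda>t. exp (X x) * (W t * (X t - X x - (b * (t - x) - a * (D t - D x))))) \<in> o[F](?g)"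
    using landau_o.big_small_mult[OF W1 hX] by simp
  have t3: "(\<lambda>t. exp (X x) * ((W t - W x) * (b * (t - x) - a * (D t - D x)))) \<in> o[F](?g)"
    using landau_o.small_big_mult[OF W0 lin] by simp
  have t4: "(\<lambda>t. exp (X x) * (W t - W x - (c - b * W x) * (t - x) - a * W x * (D t - D x))) \<in> o[F](?g)"
    using hW by simp
  have t5: "(\<lambda>t. c * (I t - I x - exp (X x) * (t - x))) \<in> o[F](?g)"
    using hI by (cases "c = 0") auto
  \<comment> \<open>The remainders add up to the whole increment exactly: the linear terms left over
    are exp (X x) times W x (b dt - a dD) + (c - b W x) dt + a W x dD - c dt, which is 0.\<close>
  have "(\<lambda>t. W t * (exp (X t) - exp (X x) - exp (X x) * (X t - X x))
      + exp (X x) * (W t * (X t - X x - (b * (t - x) - a * (D t - D x))))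
      + exp (X x) * ((W t - W x) * (b * (t - x) - a * (D t - D x)))
      + exp (X x) * (W t - W x - (c - b * W x) * (t - x) - a * W x * (D t - D x))
      - c * (I t - I x - exp (X x) * (t - x))) \<in> o[F](?g)" (is "?h \<in> _")
    by (intro sum_in_smallo t1 t2 t3 t4 t5)
  also have "?h = (\<lambda>t. (W t * exp (X t) - c * I t) - (W x * exp (X x) - c * I x))"
    by (rule ext) (simp add: algebra_simps)
  finally show ?thesis .
qed

text \<open>Let t rise to x in \<open>W_left_rate\<close>: the clock increments stay bounded, so the
  error vanishes, the time increment disappears and the increment of D tends to minus the
  jump.\<close>

lemma W_jump:
  assumes x: "0 < x" shows "W x = v x * (1 + a * j x)"
proof -
  let ?f = "\<lambda>t. W t - W x - (c - b * v x) * (t - x) - a * v x * (D t - D x)"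
  have "((\<lambda>t. A t - A x) \<longlongrightarrow> (x + (D x - j x)) - A x) (at_left x)"
    unfolding A_def by (intro tendsto_intros D_left x)
  then have "(\<lambda>t. A t - A x) \<in> O[at_left x](\<lambda>_. 1)"
    by (intro bigoI_tendsto) auto
  then have "?f \<in> o[at_left x](\<lambda>_. 1)"
    by (rule landau_o.small_big_trans[OF W_left_rate[OF x]])
  then have "(?f \<longlongrightarrow> 0) (at_left x)" using smalloD_tendsto by fastforce
  moreover have "(?f \<longlongrightarrow> v x - W x - (c - b * v x) * (x - x) - a * v x * ((D x - j x) - D x)) (at_left x)"
    by (intro tendsto_intros W_left D_left x)
  ultimately have "v x - W x - (c - b * v x) * (x - x) - a * v x * ((D x - j x) - D x) = 0"
    using tendsto_unique trivial_limit_at_left_real by blast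
  then show ?thesis by (simp add: algebra_simps)
qed

lemma X_left: "0 < x \<Longrightarrow> (X \<longlongrightarrow> X x + ln (1 + a * j x)) (at_left x)"
  unfolding X_def by (rule tendsto_eq_rhs[OF tendsto_diff[OF tendsto_mult[OF tendsto_const tendsto_ident_at] L.D_left]]) auto

lemma X_right: "0 \<le> x \<Longrightarrow> (X \<longlongrightarrow> X x) (at_right x)"
  unfolding X_def by (intro tendsto_intros L.D_right)

text \<open>\<open>product_rate\<close> settles the right side of every point and the left side of
  points without a jump. The left side of a jump time is handled by continuity.\<close>

theorem solution:
  assumes T: "0 \<le> T"
  shows "W T = (W 0 + c * I T) * exp (- X T)"
proof -
  let ?\<phi> = "\<lambda>t. W t * exp (X t) - c * I t"
  have "?\<phi> T = ?\<phi> 0"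
    using T
  proof (rule zero_increment_rate_imp_constant[where A = A])
    fix x \<epsilon> :: real assume x: "0 \<le> x" and \<epsilon>: "0 < \<epsilon>"
    have nn: "\<forall>\<^sub>F t in at_right x. x < t" by (simp add: eventually_at_right_less)
    have "(\<lambda>t. ?\<phi> t - ?\<phi> x) \<in> o[at_right x](\<lambda>t. A t - A x)"
      using x by (intro product_rate W_right X_right W_right_rate I_right_rate X_rate D_right eventually_mono[OF nn]) auto
    from landau_o.smallD[OF this \<epsilon>] nn show "\<forall>\<^sub>F t in at_right x. \<bar>?\<phi> t - ?\<phi> x\<bar> \<le> \<epsilon> * (A t - A x)"
    proof eventually_elim
      case (elim t) then show ?case using A_mono(1)[of x t] by simp
    qed
  next
    fix x \<epsilon> :: real assume x: "0 < x" and \<epsilon>: "0 < \<epsilon>"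
    have lt: "\<forall>\<^sub>F t in at_left x. 0 < t \<and> t < x"
      using x by (auto simp: eventually_at_left_field)
    show "\<forall>\<^sub>F t in at_left x. \<bar>?\<phi> x - ?\<phi> t\<bar> \<le> \<epsilon> * (A x - A t)"
    proof (cases "j x = 0")
      case True
      then have "W x = v x" using W_jump[OF x] by simp
      then have "(\<lambda>t. ?\<phi> t - ?\<phi> x) \<in> o[at_left x](\<lambda>t. A t - A x)"
        using x W_left[OF x] W_left_rate[OF x] D_left[OF x] X_left[OF x] True
        by (intro product_rate I_left_rate X_rate eventually_mono[OF lt]) auto
      from landau_o.smallD[OF this \<epsilon>] lt show ?thesis
      proof eventually_elim
        case (elim t) then show ?case using A_mono(1)[of t x] by (simp add: abs_minus_commute)
      qed
    next
      \<comment> \<open>The increment of A up to x is now at least \<open>j x > 0\<close>, so it is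
        enough that \<open>\<phi>\<close> is left continuous at x: the factor
        \<open>1 + a * j x\<close> in \<open>W x\<close> cancels the one lost by exp (X).\<close>
      case False
      then have jx: "0 < j x" using nonneg[of x] by simp
      then have "0 < 1 + a * j x" using a by (simp add: add_pos_nonneg)
      then have "v x * exp (X x + ln (1 + a * j x)) = W x * exp (X x)"
        by (simp add: W_jump[OF x] exp_add)
      then have "(?\<phi> \<longlongrightarrow> ?\<phi> x) (at_left x)"
        using tendsto_diff[OF tendsto_mult[OF W_left[OF x] tendsto_exp[OF X_left[OF x]]] tendsto_mult[OF tendsto_const I_left[OF x]], of c]
        by simp
      from tendstoD[OF this, of "\<epsilon> * j x"] lt \<epsilon> jx have "\<forall>\<^sub>F t in at_left x. dist (?\<phi> t) (?\<phi> x) < \<epsilon> * j x \<and> 0 < t \<and> t < x"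
        by (simp add: eventually_conj)
      then show ?thesis
      proof eventually_elim
        case (elim t)
        then have "j x \<le> A x - A t"
          using jump_le_D_diff[of t x x] A_mono(2)[of t x] by linarith
        then have "\<epsilon> * j x \<le> \<epsilon> * (A x - A t)" using \<epsilon> by (intro mult_left_mono) auto
        then show ?case using elim by (simp add: dist_real_def abs_minus_commute)
      qed
    qed
  qed
  moreover have "I 0 = 0" "X 0 = 0" by (simp_all add: I_def X_def L.D_def)
  ultimately have "W T * exp (X T) = W 0 + c * I T" by simp
  then show ?thesis by (simp add: exp_minus field_simps)
qed

text \<open>\<open>X x + ln (1 + a j x)\<close> is the left limit of \<open>X\<close> at \<open>x\<close>.\<close>

corollary solution_left:
  assumes x: "0 < x"
  shows "v x = (W 0 + c * I x) * exp (- (X x + ln (1 + a * j x)))"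
proof (rule tendsto_unique[OF _ W_left[OF x]])
  have "((\<lambda>t. (W 0 + c * I t) * exp (- X t)) \<longlongrightarrow> (W 0 + c * I x) * exp (- (X x + ln (1 + a * j x)))) (at_left x)"
    by (intro tendsto_intros I_left X_left x)
  then show "(W \<longlongrightarrow> (W 0 + c * I x) * exp (- (X x + ln (1 + a * j x)))) (at_left x)"
    by (rule Lim_transform_eventually)
       (use x in \<open>auto simp: eventually_at_left_field solution[symmetric] intro!: exI[of _ 0]\<close>)
qed simp

end

section \<open>Paths whose squared jumps are not summable\<close>

lemma one_plus_sum_le_prod:
  fixes f :: "'b \<Rightarrow> real"
  assumes "finite S" "\<And>x. x \<in> S \<Longrightarrow> 0 \<le> f x"
  shows "1 + sum f S \<le> (\<Prod>x\<in>S. 1 + f x)"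
  using assms
proof (induction S rule: finite_induct)
  case (insert x S)
  then have "1 + sum f S \<le> (\<Prod>x\<in>S. 1 + f x)" "0 \<le> sum f S" "0 \<le> f x"
    by (auto intro: sum_nonneg)
  then have "(1 + f x) * (1 + sum f S) \<le> (1 + f x) * (\<Prod>x\<in>S. 1 + f x)" "0 \<le> f x * sum f S"
    by (auto intro: mult_left_mono)
  then show ?case using insert by (simp add: algebra_simps)
qed simp

text \<open>Since 1 + sum of a q is at most the product of the 1 + a q, the exponential of the
  logarithmic sum bounds all finite sums of q. Used in contrapositive form: where the squared jumps
  are not summable, the logarithmic sum takes the default value 0 as well.\<close>

lemma summable_on_of_ln:
  fixes q :: "'b \<Rightarrow> real"
  assumes q: "\<And>s. 0 \<le> q s" and a: "0 < a" and s: "(\<lambda>s. ln (1 + a * q s)) summable_on B"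
  shows "q summable_on B"
proof -
  have pos: "0 < 1 + a * q s" for s using q[of s] a by (simp add: add_pos_nonneg)
  have "sum q S \<le> exp (infsum (\<lambda>s. ln (1 + a * q s)) B) / a" if S: "finite S" "S \<subseteq> B" for S
  proof -
    have "a * sum q S \<le> 1 + (\<Sum>s\<in>S. a * q s)" by (simp add: sum_distrib_left)
    also have "\<dots> \<le> (\<Prod>s\<in>S. 1 + a * q s)" using S q a by (intro one_plus_sum_le_prod) auto
    also have "\<dots> = exp (\<Sum>s\<in>S. ln (1 + a * q s))" using S pos by (simp add: exp_sum)
    also have "\<dots> \<le> exp (infsum (\<lambda>s. ln (1 + a * q s)) B)"
      using finite_sum_le_infsum[OF s S] q a by simp
    finally show ?thesis using a by (simp add: field_simps)
  qed
  then show ?thesis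
    by (intro nonneg_bdd_above_summable_on q) (auto intro!: bdd_aboveI2)
qed

text \<open>
  An infinite sum that does not converge is \<open>0\<close> by convention. If the squared jumps are not
  summable, then \<open>D\<close> can be cadlag only if both \<open>D\<close> and the sum of logarithms vanish
  identically, and the path may be treated as one without jumps.
\<close>

lemma cadlag_jump_sum:
  fixes q :: "real \<Rightarrow> real"
  assumes q: "\<And>s. 0 \<le> q s" and a: "0 < a" and D: "cadlag (\<lambda>t. infsum q {0<..t})"
  obtains j where "jump_path j"
    "\<And>t. infsum q {0<..t} = infsum j {0<..t}"
    "\<And>t. infsum (\<lambda>s. ln (1 + a * q s)) {0<..t} = infsum (\<lambda>s. ln (1 + a * j s)) {0<..t}"
proof (cases "\<forall>t. q summable_on {0<..t}")
  case True
  then show ?thesis using q by (intro that[of q]) (auto simp: jump_path_def)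
next
  case False
  define N where "N = {t. \<not> q summable_on {0<..t}}"
  \<comment> \<open>The time at which summability breaks down. After T the sum is 0 by default, so
    right continuity forces its value at T to be 0.\<close>
  define T where "T = Inf N"
  have N0: "0 < t" if "t \<in> N" for t using that by (cases "0 < t") (auto simp: N_def)
  have N: "N \<noteq> {}" "bdd_below N" using False N0 by (auto simp: N_def intro!: bdd_belowI[of _ 0] less_imp_le)
  have T0: "0 \<le> T" unfolding T_def using N N0 by (intro cInf_greatest) (auto intro: less_imp_le)
  have below: "q summable_on {0<..t}" if "t < T" for t
    using cInf_lower[OF _ N(2), of t] that unfolding T_def N_def by fastforce
  have above: "\<not> q summable_on {0<..t}" if Tt: "T < t" for t
  proof -
    obtain u where "u \<in> N" "u < t" using cInf_lessD[OF N(1), of t] Tt unfolding T_def by auto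
    then show ?thesis unfolding N_def using summable_on_subset_banach[of q "{0<..t}" "{0<..u}"] by (auto simp: subset_iff)
  qed
  have "((\<lambda>t. infsum q {0<..t}) \<longlongrightarrow> infsum q {0<..T}) (at_right T)"
    using D T0 by (auto simp: cadlag_def continuous_within)
  moreover have "\<forall>\<^sub>F t in at_right T. infsum q {0<..t} = 0"
    unfolding eventually_at_right_field using above by (auto intro!: exI[of _ "T + 1"] infsum_not_exists)
  then have "((\<lambda>t. infsum q {0<..t}) \<longlongrightarrow> 0) (at_right T)" by (rule tendsto_eventually)
  ultimately have DT: "infsum q {0<..T} = 0" by (rule tendsto_unique[rotated]) simp
  \<comment> \<open>The zero value at T means something only if the family up to T is summable. The
    left limit of the sums at T bounds every finite sum before T, and T itself adds a single
    term.\<close>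
  have sT: "q summable_on {0<..T}"
  proof (cases "T = 0")
    case False
    then have T: "0 < T" using T0 by simp
    then obtain l where l: "((\<lambda>t. infsum q {0<..t}) \<longlongrightarrow> l) (at_left T)" using D by (auto simp: cadlag_def)
    have le: "infsum q {0<..m} \<le> l" if m: "m < T" for m
    proof (rule tendsto_lowerbound[OF l])
      show "\<forall>\<^sub>F t in at_left T. infsum q {0<..m} \<le> infsum q {0<..t}"
        unfolding eventually_at_left_field
        using m by (auto intro!: exI[of _ m] infsum_mono2 below q)
    qed simp
    have "sum q S \<le> max 0 l" if S: "finite S" "S \<subseteq> {0<..<T}" for S
    proof (cases "S = {}")
      case False
      then have M: "Max S \<in> S" using S by simp
      then have mT: "Max S < T" using S by auto
      have "sum q S \<le> infsum q {0<..Max S}"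
        using S mT q by (intro finite_sum_le_infsum below) auto
      also have "\<dots> \<le> l" using le mT by simp
      finally show ?thesis by simp
    qed simp
    then have "q summable_on {0<..<T}"
      by (intro nonneg_bdd_above_summable_on q) (auto intro!: bdd_aboveI2)
    then have "q summable_on (insert T {0<..<T})" by (simp add: summable_on_insert_iff)
    moreover have "insert T {0<..<T} = {0<..T}" using T by auto
    ultimately show ?thesis by simp
  qed simp
  have q0: "q s = 0" if "0 < s" "s \<le> T" for s
    using nonneg_infsum_le_0D[of q "{0<..T}" s] DT sT q that by simp
  \<comment> \<open>Up to T all terms vanish; beyond T both sums are 0 by default.\<close>
  have "infsum q {0<..t} = 0 \<and> infsum (\<lambda>s. ln (1 + a * q s)) {0<..t} = 0" for t
  proof (cases "t \<le> T")
    case True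
    then show ?thesis using q0 by (auto intro!: infsum_0)
  next
    case False
    then show ?thesis
      using above[of t] summable_on_of_ln[OF q a, where B = "{0<..t}"] by (auto intro!: infsum_not_exists)
  qed
  then show ?thesis by (intro that[of "\<lambda>_. 0"]) (auto simp: jump_path_def)
qed

section \<open>Identification of the stochastic integral on one path\<close>

lemma has_sum_sum_lessThan:
  fixes f :: "nat \<Rightarrow> 'b \<Rightarrow> real"
  assumes "\<And>i. i < n \<Longrightarrow> (f i has_sum S i) B"
  shows "((\<lambda>x. \<Sum>i<n. f i x) has_sum (\<Sum>i<n. S i)) B"
  using assms by (induction n) (auto intro!: has_sum_add)

text \<open>Piece i of the simple integrand sees exactly the jumps in (\<tau> i, \<tau> (Suc i)] up
  to t, whose total is an increment of D. The value at time 0 never enters, as only jump times after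
  0 count.\<close>

lemma (in jump_path) step_integral:
  assumes \<tau>: "\<tau> 0 = 0" "\<And>i. i < n \<Longrightarrow> \<tau> i \<le> \<tau> (Suc i)" and t: "0 \<le> t"
  shows "((\<lambda>s. (\<Sum>i<n. if \<tau> i < s \<and> s \<le> \<tau> (Suc i) then w i else 0) * j s) has_sum
      (\<Sum>i<n. w i * (D (min (\<tau> (Suc i)) t) - D (min (\<tau> i) t)))) {0<..t}"
  unfolding sum_distrib_right
proof (rule has_sum_sum_lessThan)
  fix i assume i: "i < n"
  have nn: "0 \<le> \<tau> k" if "k \<le> n" for k
    using that by (induction k) (use \<tau> in \<open>auto intro: order_trans\<close>)
  let ?B = "{min (\<tau> i) t<..min (\<tau> (Suc i)) t}"
  have "j summable_on ?B" using t nn[of i] i by (intro summable_on_bounded[of _ t]) auto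
  then have "((\<lambda>s. w i * j s) has_sum w i * infsum j ?B) ?B"
    by (intro has_sum_cmult_right has_sum_infsum)
  also have "infsum j ?B = D (min (\<tau> (Suc i)) t) - D (min (\<tau> i) t)"
    using t nn[of i] i \<tau>(2)[OF i] by (intro D_diff[symmetric]) auto
  also have "((\<lambda>s. w i * j s) has_sum w i * (D (min (\<tau> (Suc i)) t) - D (min (\<tau> i) t))) ?B \<longleftrightarrow>
      ((\<lambda>s. (if \<tau> i < s \<and> s \<le> \<tau> (Suc i) then w i else 0) * j s) has_sum
        w i * (D (min (\<tau> (Suc i)) t) - D (min (\<tau> i) t))) {0<..t}"
    using t nn[of i] i by (intro has_sum_cong_neutral) auto
  finally show "((\<lambda>s. (if \<tau> i < s \<and> s \<le> \<tau> (Suc i) then w i else 0) * j s) has_sum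
        w i * (D (min (\<tau> (Suc i)) t) - D (min (\<tau> i) t))) {0<..t}" .
qed

text \<open>Gives Borel measurability of the volatility path from the simple processes that
  approximate it uniformly, without an analysis of left limits.\<close>

lemma borel_measurable_uniform_approx:
  fixes f :: "real \<Rightarrow> real"
  assumes A: "A \<in> sets borel"
    and approx: "\<And>e. 0 < e \<Longrightarrow> \<exists>g \<in> borel_measurable borel. \<forall>x\<in>A. \<bar>g x - f x\<bar> \<le> e"
  shows "(\<lambda>x. indicator A x * f x) \<in> borel_measurable borel"
proof -
  have "\<forall>n::nat. \<exists>g. g \<in> borel_measurable borel \<and> (\<forall>x\<in>A. \<bar>g x - f x\<bar> \<le> inverse (real (Suc n)))"
    using approx by (metis inverse_positive_iff_positive of_nat_0_less_iff zero_less_Suc)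
  then obtain g where g: "\<And>n. g n \<in> borel_measurable borel"
    "\<And>n x. x \<in> A \<Longrightarrow> \<bar>g n x - f x\<bar> \<le> inverse (real (Suc n))"
    by metis
  show ?thesis
  proof (rule borel_measurable_LIMSEQ_real)
    show "(\<lambda>x. indicator A x * g n x) \<in> borel_measurable borel" for n using g(1) A by measurable
    show "(\<lambda>n. indicator A x * g n x) \<longlonglongrightarrow> indicator A x * f x" for x
    proof (cases "x \<in> A")
      case True
      have "(\<lambda>n. g n x - f x) \<longlonglongrightarrow> 0"
        by (rule Lim_null_comparison[OF _ LIMSEQ_inverse_real_of_nat]) (use g(2) True in auto)
      then show ?thesis using True by (simp add: LIM_zero_iff)
    qed simp
  qed
qed

lemma measurable_simple_process_path: "(\<lambda>t. simple_process K t \<omega>) \<in> borel_measurable borel"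
  unfolding simple_process_def by measurable

lemma simple_process_bounded: "\<exists>B. \<forall>t. \<bar>simple_process K t \<omega>\<bar> \<le> B"
proof (intro exI allI)
  fix t
  have "\<bar>simple_process K t \<omega>\<bar> \<le> \<bar>initial K \<omega>\<bar> + \<bar>\<Sum>i<pieces K. if nodes K i \<omega> < t \<and> t \<le> nodes K (Suc i) \<omega> then weights K i \<omega> else 0\<bar>"
    unfolding simple_process_def by auto
  also have "\<dots> \<le> \<bar>initial K \<omega>\<bar> + (\<Sum>i<pieces K. \<bar>weights K i \<omega>\<bar>)"
    by (intro add_left_mono order_trans[OF sum_abs] sum_mono) auto
  finally show "\<bar>simple_process K t \<omega>\<bar> \<le> \<bar>initial K \<omega>\<bar> + (\<Sum>i<pieces K. \<bar>weights K i \<omega>\<bar>)" .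
qed

lemma left_limit_tendsto:
  assumes "cadlag f" "0 < t" shows "(f \<longlongrightarrow> left_limit f t) (at_left t)"
proof -
  obtain l where l: "(f \<longlongrightarrow> l) (at_left t)" using assms by (auto simp: cadlag_def)
  then have "left_limit f t = l" using assms(2) by (simp add: left_limit_def tendsto_Lim)
  then show ?thesis using l by simp
qed

text \<open>The hypothesis \<open>approx\<close> is all that is used of the stochastic integral, for
  one fixed outcome; the approximant may change with t and e. The driver in it ignores its outcome
  argument because the path is already frozen. Here k is \<open>\<alpha>\<^sub>0\<close>, z the path
  of the integral, and h the volatility at positive times; at time 0, h equals k, the left limit
  there being 0.\<close>

lemma volatility_path_formula:
  fixes y q z h :: "real \<Rightarrow> real"
  assumes q: "\<And>s. 0 \<le> q s" and cD: "cadlag (\<lambda>t. infsum q {0<..t})" and cy: "cadlag y"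
    and a: "0 < a" and b: "0 < b"
    and h: "\<And>t. h t = k + a * left_limit y t"
    and eq: "\<And>t. 0 \<le> t \<Longrightarrow> y t = y 0 + (LINT s:{0..t}|lborel. - b * left_limit y s) + z t"
    and approx: "\<And>t e. 0 \<le> t \<Longrightarrow> 0 < e \<Longrightarrow> \<exists>K. nodes K 0 \<omega> = 0 \<and>
      (\<forall>i<pieces K. nodes K i \<omega> \<le> nodes K (Suc i) \<omega>) \<and>
      (\<forall>s\<in>{0..t}. \<bar>simple_process K s \<omega> - h s\<bar> \<le> e) \<and>
      (\<forall>s\<in>{0..t}. \<bar>simple_integral (\<lambda>t _. infsum q {0<..t}) K s \<omega> - z s\<bar> \<le> e)"
    and X: "\<And>t. X t = b * t - infsum (\<lambda>s. ln (1 + a * q s)) {0<..t}"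
    and t: "0 < t"
  shows "h t = (k + a * y 0 + k * b * (LINT s:{0..t}|lborel. exp (X s))) * exp (- left_limit X t)"
proof -
  obtain j where j: "jump_path j" "\<And>t. infsum q {0<..t} = infsum j {0<..t}"
    "\<And>t. infsum (\<lambda>s. ln (1 + a * q s)) {0<..t} = infsum (\<lambda>s. ln (1 + a * j s)) {0<..t}"
    using cadlag_jump_sum[OF q a cD] by blast
  interpret J: jump_path j by (rule j)
  \<comment> \<open>One approximant with tolerance 1 suffices, since a simple path takes finitely
    many values.\<close>
  have bounded: "\<exists>B. \<forall>u\<in>{0..t}. \<bar>h u\<bar> \<le> B" for t
  proof (cases "0 \<le> t")
    case True
    then obtain K where K: "\<forall>s\<in>{0..t}. \<bar>simple_process K s \<omega> - h s\<bar> \<le> 1"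
      using approx[of t 1] by auto
    obtain B where "\<forall>t. \<bar>simple_process K t \<omega>\<bar> \<le> B" using simple_process_bounded by metis
    then have "\<bar>h u\<bar> \<le> B + 1" if "u \<in> {0..t}" for u using K that by (smt (verit))
    then show ?thesis by blast
  qed simp
  have h_int: "set_integrable lborel {0..t} h" for t
  proof -
    have "(\<lambda>x. indicator {0..t} x * h x) \<in> borel_measurable borel"
    proof (rule borel_measurable_uniform_approx)
      fix e :: real assume e: "0 < e"
      show "\<exists>g\<in>borel_measurable borel. \<forall>x\<in>{0..t}. \<bar>g x - h x\<bar> \<le> e"
      proof (cases "0 \<le> t")
        case True
        then obtain K where "\<forall>s\<in>{0..t}. \<bar>simple_process K s \<omega> - h s\<bar> \<le> e"
          using approx[OF True e] by blast
        then show ?thesis by (intro bexI[OF _ measurable_simple_process_path]) auto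
      next
        case False
        then show ?thesis by (intro bexI[of _ "\<lambda>_. 0"]) auto
      qed
    qed simp
    moreover obtain B where "\<forall>u\<in>{0..t}. \<bar>h u\<bar> \<le> B" using bounded by blast
    ultimately have "set_integrable lborel {0..t} (\<lambda>x. indicator {0..t} x * h x)"
      by (intro set_integrable_bounded_Icc[where B = B]) auto
    then show ?thesis unfolding set_integrable_def
      by (rule Bochner_Integration.integrable_cong[THEN iffD1, rotated 2]) (auto simp: indicator_def)
  qed
  have z: "z t = infsum (\<lambda>s. h s * j s) {0<..t}" if t: "0 \<le> t" for t
  proof -
    have small: "\<bar>z t - infsum (\<lambda>s. h s * j s) {0<..t}\<bar> \<le> e" if "0 < e" for e
    proof -
      \<comment> \<open>Two errors add up to e: d from the simple integral to z, and d times D t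
        from exchanging the integrands.\<close>
      define d where "d = e / (1 + J.D t)"
      have D0: "0 \<le> J.D t" unfolding J.D_def by (intro infsum_nonneg J.nonneg)
      then have "0 < d" "d * (1 + J.D t) = e" using that by (auto simp: d_def)
      then have d: "0 < d" "d + d * J.D t = e" by (simp_all add: distrib_left)
      obtain K where K: "nodes K 0 \<omega> = 0" "\<And>i. i < pieces K \<Longrightarrow> nodes K i \<omega> \<le> nodes K (Suc i) \<omega>"
        "\<And>s. s \<in> {0..t} \<Longrightarrow> \<bar>simple_process K s \<omega> - h s\<bar> \<le> d"
        "\<bar>simple_integral (\<lambda>t _. infsum q {0<..t}) K t \<omega> - z t\<bar> \<le> d"
        using approx[OF t d(1)] t by auto
      have "((\<lambda>s. simple_process K s \<omega> * j s) has_sum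
          simple_integral (\<lambda>t _. infsum q {0<..t}) K t \<omega>) {0<..t}"
        unfolding simple_integral_def j(2) J.D_def[symmetric]
        by (rule has_sum_cong[THEN iffD1, OF _ J.step_integral[of "\<lambda>i. nodes K i \<omega>" "pieces K" t
              "\<lambda>i. weights K i \<omega>", OF K(1,2) t]]) (auto simp: simple_process_def)
      then have s: "(\<lambda>s. simple_process K s \<omega> * j s) summable_on {0<..t}"
        and i: "infsum (\<lambda>s. simple_process K s \<omega> * j s) {0<..t} = simple_integral (\<lambda>t _. infsum q {0<..t}) K t \<omega>"
        by (auto simp: has_sum_iff)
      have "\<bar>infsum (\<lambda>s. h s * j s) {0<..t} - infsum (\<lambda>s. simple_process K s \<omega> * j s) {0<..t}\<bar>
          \<le> d * infsum j {0<..t}"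
        by (rule infsum_bound_diff(2)[OF J.nonneg J.summable _ s])
           (use K(3) in \<open>auto simp: abs_minus_commute\<close>)
      then show ?thesis using K(4) d(2) unfolding i J.D_def by linarith
    qed
    have "\<bar>z t - infsum (\<lambda>s. h s * j s) {0<..t}\<bar> \<le> 0"
      by (rule field_le_epsilon) (simp only: small add_0_left)
    then show ?thesis by simp
  qed
  \<comment> \<open>Multiplying the equation for y by a and adding k turns the drift - a b y into k
    b - b h, whence the constant \<open>k * b\<close>.\<close>
  interpret C: cogarch_path j "\<lambda>t. k + a * y t" h a b "k * b"
  proof
    show "((\<lambda>t. k + a * y t) \<longlongrightarrow> k + a * y x) (at_right x)" if "0 \<le> x" for x
      using cy that by (intro tendsto_intros) (auto simp: cadlag_def continuous_within)
    show "((\<lambda>t. k + a * y t) \<longlongrightarrow> h x) (at_left x)" if "0 < x" for x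
      unfolding h using cy that by (intro tendsto_intros left_limit_tendsto)
    show "\<exists>B. \<forall>u\<in>{0<..t}. \<bar>h u\<bar> \<le> B" for t
      using bounded[of t] by (meson atLeastAtMost_iff greaterThanAtMost_iff less_imp_le)
    show "h integrable_on {0..t}" for t
      using set_borel_integral_eq_integral(1)[OF h_int] .
    show "k + a * y t = k + a * y 0 + integral {0..t} (\<lambda>u. k * b - b * h u) + a * (\<Sum>\<^sub>\<infinity>u\<in>{0<..t}. h u * j u)"
      if "0 \<le> t" for t
    proof -
      have c: "set_integrable lborel {0..t} (\<lambda>_. k * b)"
        by (rule set_integrable_bounded_Icc[where B = "\<bar>k * b\<bar>"]) auto
      have i: "set_integrable lborel {0..t} (\<lambda>u. k * b - b * h u)"
        using set_integral_diff(1)[OF c] set_integrable_mult_right[OF h_int] by blast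
      have "a * (LINT s:{0..t}|lborel. - b * left_limit y s) = (LINT s:{0..t}|lborel. a * (- b * left_limit y s))"
        by (rule set_integral_mult_right[symmetric])
      also have "(\<lambda>s. a * (- b * left_limit y s)) = (\<lambda>u. k * b - b * h u)"
        by (auto simp: h algebra_simps)
      also have "(LINT u:{0..t}|lborel. k * b - b * h u) = integral {0..t} (\<lambda>u. k * b - b * h u)"
        by (rule set_borel_integral_eq_integral(2)[OF i])
      finally have "integral {0..t} (\<lambda>u. k * b - b * h u) = a * (LINT s:{0..t}|lborel. - b * left_limit y s)"
        by simp
      then show ?thesis using eq[OF that] z[OF that] by (simp add: distrib_left)
    qed
  qed (use a b in auto)
  have XC: "X = C.X" using j(3) by (auto simp: X C.X_def C.L.D_def)
  have "left_limit X t = X t + ln (1 + a * j t)"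
    using C.X_left[OF t] t by (simp add: left_limit_def tendsto_Lim XC)
  moreover have "C.I t = (LINT s:{0..t}|lborel. exp (X s))"
    unfolding C.I_def XC using set_borel_integral_eq_integral(2)[OF C.exp_X_set_integrable] by simp
  ultimately show ?thesis using C.solution_left[OF t] by (simp add: XC)
qed

section \<open>Complete filtrations and ucp convergence\<close>

locale complete_prob_space = prob_space M + complete_measure M for M
begin

lemma borel_measurable_cong_AE:
  fixes f g :: "'a \<Rightarrow> real"
  assumes f: "f \<in> borel_measurable M" and eq: "AE \<omega> in M. f \<omega> = g \<omega>"
  shows "g \<in> borel_measurable M"
proof (rule measurableI)
  fix B :: "real set" assume "B \<in> sets borel"
  then have "f -` B \<inter> space M \<in> sets M" using f by (rule measurable_sets[rotated])
  then show "g -` B \<inter> space M \<in> sets M"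
    by (rule in_sets_AE[rotated]) (use eq in auto)
qed auto

text \<open>By completeness either both events are measurable or neither is, and in the latter case
  both measures are 0 by default.\<close>

lemma measure_cong_AE:
  assumes eq: "AE \<omega> in M. P \<omega> \<longleftrightarrow> Q \<omega>"
  shows "measure M {\<omega> \<in> space M. P \<omega>} = measure M {\<omega> \<in> space M. Q \<omega>}"
proof (cases "{\<omega> \<in> space M. P \<omega>} \<in> sets M")
  case True
  then have "{\<omega> \<in> space M. Q \<omega>} \<in> sets M"
    by (rule in_sets_AE[rotated]) (use eq in auto)
  then show ?thesis using True eq by (intro measure_eq_AE) auto
next
  case False
  have "{\<omega> \<in> space M. Q \<omega>} \<notin> sets M"
  proof
    assume "{\<omega> \<in> space M. Q \<omega>} \<in> sets M"
    then have "{\<omega> \<in> space M. P \<omega>} \<in> sets M"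
      by (rule in_sets_AE[rotated]) (use eq in auto)
    then show False using False by simp
  qed
  then show ?thesis using False by (simp add: measure_notin_sets)
qed

text \<open>A strict excess at an interior time persists at a nearby rational on the side where the
  path is continuous, so countably many times decide the event up to a null set. The endpoints are
  added to \<open>Q\<close> because a rational on the right side of them inside [0, t] need not
  exist. Either side is allowed: integrands are left continuous, integrals right continuous.\<close>

lemma sup_event_sets:
  fixes X :: "real \<Rightarrow> 'a \<Rightarrow> real"
  assumes t: "0 \<le> t" and X: "\<And>s. 0 \<le> s \<Longrightarrow> X s \<in> borel_measurable M"
    and cont: "AE \<omega> in M. (\<forall>s>0. continuous (at_left s) (\<lambda>s. X s \<omega>)) \<or>
      (\<forall>s\<ge>0. continuous (at_right s) (\<lambda>s. X s \<omega>))"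
  shows "{\<omega> \<in> space M. \<exists>s\<in>{0..t}. e < \<bar>X s \<omega>\<bar>} \<in> sets M"
proof (rule in_sets_AE)
  define Q where "Q = {0, t} \<union> (\<rat> \<inter> {0..t})"
  have Q: "countable Q" "Q \<subseteq> {0..t}" using t by (auto simp: Q_def countable_rat)
  show "{\<omega> \<in> space M. \<exists>s\<in>Q. e < \<bar>X s \<omega>\<bar>} \<in> sets M"
  proof -
    have "{\<omega> \<in> space M. \<exists>s\<in>Q. e < \<bar>X s \<omega>\<bar>} = (\<Union>s\<in>Q. {\<omega> \<in> space M. e < \<bar>X s \<omega>\<bar>})" by auto
    moreover have "{\<omega> \<in> space M. e < \<bar>X s \<omega>\<bar>} \<in> sets M" if "s \<in> Q" for s
    proof -
      have [measurable]: "X s \<in> borel_measurable M" using X Q(2) that by auto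
      show ?thesis by measurable
    qed
    ultimately show ?thesis using Q(1) by auto
  qed
  from cont show "AE \<omega> in M. \<omega> \<in> {\<omega> \<in> space M. \<exists>s\<in>Q. e < \<bar>X s \<omega>\<bar>} \<longleftrightarrow>
      \<omega> \<in> {\<omega> \<in> space M. \<exists>s\<in>{0..t}. e < \<bar>X s \<omega>\<bar>}"
  proof eventually_elim
    case (elim \<omega>)
    have "\<exists>r\<in>Q. e < \<bar>X r \<omega>\<bar>" if s: "s \<in> {0..t}" "e < \<bar>X s \<omega>\<bar>" for s
    proof (cases "s = 0 \<or> s = t")
      case True then show ?thesis using s by (auto simp: Q_def)
    next
      case False
      then have st: "0 < s" "s < t" using s by auto
      from elim show ?thesis
      proof
        assume "\<forall>s>0. continuous (at_left s) (\<lambda>s. X s \<omega>)"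
        then have "((\<lambda>s. \<bar>X s \<omega>\<bar>) \<longlongrightarrow> \<bar>X s \<omega>\<bar>) (at_left s)"
          using st by (intro tendsto_intros) (simp add: continuous_within)
        from order_tendstoD(1)[OF this s(2)] obtain l where
          l: "l < s" "\<And>u. l < u \<Longrightarrow> u < s \<Longrightarrow> e < \<bar>X u \<omega>\<bar>"
          unfolding eventually_at_left_field by blast
        obtain r where "r \<in> \<rat>" "max 0 l < r" "r < s" using Rats_dense_in_real[of "max 0 l" s] l st by auto
        then show ?thesis using l(2)[of r] st by (intro bexI[of _ r]) (auto simp: Q_def)
      next
        assume "\<forall>s\<ge>0. continuous (at_right s) (\<lambda>s. X s \<omega>)"
        then have "((\<lambda>s. \<bar>X s \<omega>\<bar>) \<longlongrightarrow> \<bar>X s \<omega>\<bar>) (at_right s)"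
          using st by (intro tendsto_intros) (simp add: continuous_within)
        from order_tendstoD(1)[OF this s(2)] obtain l where
          l: "s < l" "\<And>u. s < u \<Longrightarrow> u < l \<Longrightarrow> e < \<bar>X u \<omega>\<bar>"
          unfolding eventually_at_right_field by blast
        obtain r where "r \<in> \<rat>" "s < r" "r < min t l" using Rats_dense_in_real[of s "min t l"] l st by auto
        then show ?thesis using l(2)[of r] st by (intro bexI[of _ r]) (auto simp: Q_def)
      qed
    qed
    then show ?case using Q(2) by blast
  qed
qed auto

lemma measurable_at_random_time:
  fixes X :: "real \<Rightarrow> 'a \<Rightarrow> real"
  assumes X: "\<And>s. 0 \<le> s \<Longrightarrow> X s \<in> borel_measurable M"
    and cont: "AE \<omega> in M. \<forall>s\<ge>0. continuous (at_right s) (\<lambda>s. X s \<omega>)"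
    and T [measurable]: "T \<in> borel_measurable M" and T0: "\<And>\<omega>. \<omega> \<in> space M \<Longrightarrow> 0 \<le> T \<omega>"
  shows "(\<lambda>\<omega>. X (T \<omega>) \<omega>) \<in> borel_measurable M"
proof -
  \<comment> \<open>Grid approximation of x from strictly above, the 1 making it strict: at each
    level it takes countably many values, and right continuity of X recovers the value at x.\<close>
  define r where "r n x = (real (nat \<lfloor>real (Suc n) * x\<rfloor>) + 1) / real (Suc n)" for n x
  have r: "x < r n x" "r n x \<le> x + inverse (real (Suc n))" if "0 \<le> x" for n x
  proof -
    have "0 \<le> real (Suc n) * x" using that by simp
    then have "real (nat \<lfloor>real (Suc n) * x\<rfloor>) = of_int \<lfloor>real (Suc n) * x\<rfloor>" by simp
    then have "real (Suc n) * x < real (nat \<lfloor>real (Suc n) * x\<rfloor>) + 1"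
      "real (nat \<lfloor>real (Suc n) * x\<rfloor>) + 1 \<le> real (Suc n) * x + 1"
      by linarith+
    then show "x < r n x" "r n x \<le> x + inverse (real (Suc n))"
      unfolding r_def by (auto simp: field_simps simp del: of_nat_Suc)
  qed
  have lim: "filterlim (\<lambda>n. r n x) (at_right x) sequentially" if "0 \<le> x" for x
    unfolding filterlim_at
  proof
    show "\<forall>\<^sub>F n in sequentially. r n x \<in> {x<..} \<and> r n x \<noteq> x" using r(1)[OF that] by (auto intro!: always_eventually) (metis less_irrefl)
    show "(\<lambda>n. r n x) \<longlonglongrightarrow> x"
    proof (rule tendsto_sandwich[OF _ _ tendsto_const])
      show "(\<lambda>n. x + inverse (real (Suc n))) \<longlonglongrightarrow> x"
        using tendsto_add[OF tendsto_const[of x] LIMSEQ_inverse_real_of_nat] by simp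
    qed (use r[OF that] in \<open>auto intro!: always_eventually less_imp_le\<close>)
  qed
  obtain N where N: "{\<omega> \<in> space M. \<not> (\<forall>s\<ge>0. continuous (at_right s) (\<lambda>s. X s \<omega>))} \<subseteq> N" "N \<in> null_sets M"
    using cont unfolding eventually_ae_filter by auto
  have [measurable]: "N \<in> sets M" using N by auto
  have "(\<lambda>\<omega>. indicator (space M - N) \<omega> * X (T \<omega>) \<omega>) \<in> borel_measurable M"
  proof (rule borel_measurable_LIMSEQ_real)
    show "(\<lambda>\<omega>. indicator (space M - N) \<omega> * X (r n (T \<omega>)) \<omega>) \<in> borel_measurable M" for n
    proof -
      have "(\<lambda>\<omega>. X ((real (nat \<lfloor>real (Suc n) * T \<omega>\<rfloor>) + 1) / real (Suc n)) \<omega>) \<in> borel_measurable M"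
      proof (rule measurable_compose_countable[where f = "\<lambda>k \<omega>. X ((real k + 1) / real (Suc n)) \<omega>"])
        show "(\<lambda>\<omega>. X ((real k + 1) / real (Suc n)) \<omega>) \<in> borel_measurable M" for k by (rule X) simp
      qed measurable
      then show ?thesis unfolding r_def by measurable
    qed
    show "(\<lambda>n. indicator (space M - N) \<omega> * X (r n (T \<omega>)) \<omega>) \<longlonglongrightarrow> indicator (space M - N) \<omega> * X (T \<omega>) \<omega>"
      if \<omega>: "\<omega> \<in> space M" for \<omega>
    proof (cases "\<omega> \<in> N")
      case False
      then have "((\<lambda>s. X s \<omega>) \<longlongrightarrow> X (T \<omega>) \<omega>) (at_right (T \<omega>))"
        using N(1) \<omega> T0[OF \<omega>] by (auto simp: continuous_within)
      from filterlim_compose[OF this lim[OF T0[OF \<omega>]]] show ?thesis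
        by (intro tendsto_mult tendsto_const)
    qed simp
  qed
  then show ?thesis
    by (rule borel_measurable_cong_AE) (use AE_not_in[OF N(2)] in \<open>auto simp: indicator_def\<close>)
qed

text \<open>For each m a single index makes both processes exceed 2^-m on [0, m] with probability
  below 2^-m; Borel-Cantelli does the rest. The index is common to A and B because an integrand and
  its integral must be approximated by the same simple process.\<close>

lemma ucp_tendsto_AE_approx:
  fixes A B :: "nat \<Rightarrow> real \<Rightarrow> 'a \<Rightarrow> real"
  assumes A: "ucp_tendsto M A A'" and B: "ucp_tendsto M B B'"
    and mA: "\<And>n t e. 0 \<le> t \<Longrightarrow> {\<omega> \<in> space M. \<exists>s\<in>{0..t}. e < \<bar>A n s \<omega> - A' s \<omega>\<bar>} \<in> sets M"
    and mB: "\<And>n t e. 0 \<le> t \<Longrightarrow> {\<omega> \<in> space M. \<exists>s\<in>{0..t}. e < \<bar>B n s \<omega> - B' s \<omega>\<bar>} \<in> sets M"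
  shows "AE \<omega> in M. \<forall>t\<ge>0. \<forall>e>0. \<exists>n.
    (\<forall>s\<in>{0..t}. \<bar>A n s \<omega> - A' s \<omega>\<bar> \<le> e) \<and> (\<forall>s\<in>{0..t}. \<bar>B n s \<omega> - B' s \<omega>\<bar> \<le> e)"
proof -
  define EA where "EA n m = {\<omega> \<in> space M. \<exists>s\<in>{0..real m}. (1/2)^m < \<bar>A n s \<omega> - A' s \<omega>\<bar>}" for n m
  define EB where "EB n m = {\<omega> \<in> space M. \<exists>s\<in>{0..real m}. (1/2)^m < \<bar>B n s \<omega> - B' s \<omega>\<bar>}" for n m
  have [measurable]: "EA n m \<in> sets M" "EB n m \<in> sets M" for n m
    unfolding EA_def EB_def by (auto intro: mA mB)
  have "\<exists>n. prob (EA n m) < (1/2)^m \<and> prob (EB n m) < (1/2)^m" for m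
  proof -
    have "(\<lambda>n. prob (EA n m)) \<longlonglongrightarrow> 0" "(\<lambda>n. prob (EB n m)) \<longlonglongrightarrow> 0"
      using A B unfolding ucp_tendsto_def EA_def EB_def by auto
    then have "\<forall>\<^sub>F n in sequentially. prob (EA n m) < (1/2)^m \<and> prob (EB n m) < (1/2)^m"
      by (intro eventually_conj order_tendstoD(2)[where y = 0]) auto
    then show ?thesis using eventually_happens sequentially_bot by blast
  qed
  then obtain n where n: "\<And>m. prob (EA (n m) m) < (1/2)^m" "\<And>m. prob (EB (n m) m) < (1/2)^m"
    by metis
  let ?C = "\<lambda>m. EA (n m) m \<union> EB (n m) m"
  have le: "prob (?C m) \<le> 2 * (1/2)^m" for m
    using measure_Un_le[of "EA (n m) m" M "EB (n m) m"] n[of m] by simp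
  have "summable (\<lambda>m. 2 * (1/2::real)^m)" by (intro summable_mult summable_geometric) simp
  then have "summable (\<lambda>m. prob (?C m))"
    by (rule summable_comparison_test'[where N = 0]) (simp only: real_norm_def abs_of_nonneg[OF measure_nonneg] le)
  then have "AE \<omega> in M. \<forall>\<^sub>F m in sequentially. \<omega> \<in> space M - ?C m"
    by (intro borel_cantelli_AE1) (auto simp: less_top[symmetric])
  then show ?thesis
  proof eventually_elim
    case (elim \<omega>)
    show ?case
    proof (intro allI impI)
      fix t e :: real assume "0 \<le> t" and e: "0 < e"
      have "(\<lambda>m. (1/2::real)^m) \<longlonglongrightarrow> 0" by (rule LIMSEQ_power_zero) simp
      from order_tendstoD(2)[OF this e]
      have "\<forall>\<^sub>F m in sequentially. (1/2)^m < e" .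
      moreover have "\<forall>\<^sub>F m in sequentially. t \<le> real m"
        using eventually_ge_at_top[of "nat \<lceil>t\<rceil>"] by eventually_elim linarith
      ultimately have "\<forall>\<^sub>F m in sequentially. \<omega> \<in> space M - ?C m \<and> (1/2)^m < e \<and> t \<le> real m"
        using elim by (intro eventually_conj)
      then obtain m where m: "\<omega> \<in> space M - ?C m" "(1/2)^m < e" "t \<le> real m"
        using eventually_happens sequentially_bot by blast
      then have "\<bar>A (n m) s \<omega> - A' s \<omega>\<bar> \<le> e \<and> \<bar>B (n m) s \<omega> - B' s \<omega>\<bar> \<le> e" if "s \<in> {0..t}" for s
      proof -
        have "s \<in> {0..real m}" using that m(3) by auto
        then have "\<bar>A (n m) s \<omega> - A' s \<omega>\<bar> \<le> (1/2)^m" "\<bar>B (n m) s \<omega> - B' s \<omega>\<bar> \<le> (1/2)^m"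
          using m(1) unfolding EA_def EB_def by (auto simp: not_less)
        then show ?thesis using m(2) by linarith
      qed
      then show "\<exists>n. (\<forall>s\<in>{0..t}. \<bar>A n s \<omega> - A' s \<omega>\<bar> \<le> e) \<and> (\<forall>s\<in>{0..t}. \<bar>B n s \<omega> - B' s \<omega>\<bar> \<le> e)"
        by blast
    qed
  qed
qed

end

section \<open>Measurability and one-sided continuity of simple processes and their
  integrals\<close>

locale complete_filtration = complete_prob_space M + filtration "space M" F
  for M :: "'a measure" and F :: "real \<Rightarrow> 'a measure" +
  assumes F_sub: "sets (F t) \<subseteq> sets M"
    and null_F: "null_sets M \<subseteq> sets (F 0)"
begin

lemma measurable_F: "f \<in> borel_measurable (F t) \<Longrightarrow> f \<in> borel_measurable M"
  by (rule measurable_from_subalg[of M "F t"]) (auto simp: subalgebra_def space_F F_sub)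

lemma adapted_measurable: "adapted F X \<Longrightarrow> 0 \<le> t \<Longrightarrow> X t \<in> borel_measurable M"
  unfolding adapted_def using measurable_F by blast

text \<open>As T is finite, A is the countable union of its parts on which T is at most n, and each
  part lies in the filtration at time n.\<close>

lemma measurable_pre_sigma:
  assumes T: "stopping_time F T" and f: "f \<in> borel_measurable (pre_sigma T)"
  shows "f \<in> borel_measurable M"
proof (rule measurable_from_subalg[OF _ f])
  have "A \<in> sets M" if A: "A \<in> sets (pre_sigma T)" for A
  proof -
    have "{\<omega> \<in> A. T \<omega> \<le> real n} \<in> sets M" for n
      using sets_pre_sigmaD[OF T A, of "real n"] F_sub by blast
    then have "(\<Union>n::nat. {\<omega> \<in> A. T \<omega> \<le> real n}) \<in> sets M"
      by (intro sets.countable_nat_UN) auto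
    also have "(\<Union>n::nat. {\<omega> \<in> A. T \<omega> \<le> real n}) = A" by (auto intro: real_arch_simple)
    finally show ?thesis .
  qed
  then show "subalgebra M (pre_sigma T)" by (auto simp: subalgebra_def space_pre_sigma)
qed

context
  fixes K :: "'a simple_integrand"
  assumes K: "simple_predictable M F K"
begin

lemma nodes_measurable: "i \<le> pieces K \<Longrightarrow> nodes K i \<in> borel_measurable M"
  using K F_sub space_F by (intro measurable_stopping_time[of F]) (auto simp: simple_predictable_def)

lemma weights_measurable: "i < pieces K \<Longrightarrow> weights K i \<in> borel_measurable M"
  using K by (intro measurable_pre_sigma[of "nodes K i"]) (auto simp: simple_predictable_def)

lemma nodes_nonneg: "i \<le> pieces K \<Longrightarrow> \<omega> \<in> space M \<Longrightarrow> 0 \<le> nodes K i \<omega>"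
proof (induction i)
  case 0 then show ?case using K by (simp add: simple_predictable_def)
next
  case (Suc i)
  then have "nodes K i \<omega> \<le> nodes K (Suc i) \<omega>" using K by (simp add: simple_predictable_def)
  then show ?case using Suc by simp
qed

lemma simple_process_measurable: "simple_process K t \<in> borel_measurable M"
proof -
  have [measurable]: "initial K \<in> borel_measurable M"
    using K measurable_F by (auto simp: simple_predictable_def)
  have "(\<lambda>\<omega>. if nodes K i \<omega> < t \<and> t \<le> nodes K (Suc i) \<omega> then weights K i \<omega> else 0) \<in> borel_measurable M"
    if "i \<in> {..<pieces K}" for i
  proof -
    have [measurable]: "nodes K i \<in> borel_measurable M" "nodes K (Suc i) \<in> borel_measurable M"
      "weights K i \<in> borel_measurable M"
      using that nodes_measurable weights_measurable by auto
    show ?thesis by measurable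
  qed
  note [measurable] = borel_measurable_sum[OF this]
  have "(\<lambda>\<omega>. simple_process K t \<omega>) \<in> borel_measurable M" unfolding simple_process_def by measurable
  then show ?thesis .
qed

lemma simple_integral_measurable:
  assumes X: "\<And>s. 0 \<le> s \<Longrightarrow> X s \<in> borel_measurable M" "AE \<omega> in M. cadlag (\<lambda>t. X t \<omega>)" and t: "0 \<le> t"
  shows "simple_integral X K t \<in> borel_measurable M"
proof -
  have c: "AE \<omega> in M. \<forall>s\<ge>0. continuous (at_right s) (\<lambda>s. X s \<omega>)"
    using X(2) by eventually_elim (simp add: cadlag_def)
  have node: "(\<lambda>\<omega>. X (min (nodes K i \<omega>) t) \<omega>) \<in> borel_measurable M" if "i \<le> pieces K" for i
  proof (rule measurable_at_random_time[OF X(1) c])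
    have [measurable]: "nodes K i \<in> borel_measurable M" using that by (rule nodes_measurable)
    show "(\<lambda>\<omega>. min (nodes K i \<omega>) t) \<in> borel_measurable M" by measurable
    show "0 \<le> min (nodes K i \<omega>) t" if "\<omega> \<in> space M" for \<omega>
      using nodes_nonneg[OF \<open>i \<le> pieces K\<close> that] t by simp
  qed
  have "(\<lambda>\<omega>. simple_integral X K t \<omega>) \<in> borel_measurable M"
    unfolding simple_integral_def
    by (intro borel_measurable_sum borel_measurable_times borel_measurable_diff node weights_measurable) auto
  then show ?thesis .
qed

end

end

text \<open>As u rises to s, each of the finitely many comparisons of a node with u settles at its
  value for s; for a node equal to s both are false.\<close>

lemma simple_process_left_continuous:
  assumes s: "0 < s" shows "continuous (at_left s) (\<lambda>t. simple_process K t \<omega>)"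
proof -
  have ev: "\<forall>\<^sub>F u in at_left s. 0 < u \<and> u < s" using s by (auto simp: eventually_at_left_field)
  have lt: "\<forall>\<^sub>F u in at_left s. (x < u) = (x < s)" for x
  proof (cases "x < s")
    case True
    then show ?thesis by (auto simp: eventually_at_left_field)
  next
    case False
    then show ?thesis by (auto simp: eventually_at_left_field intro!: exI[of _ "s - 1"])
  qed
  have "\<forall>\<^sub>F u in at_left s. \<forall>i\<in>{..pieces K}. (nodes K i \<omega> < u) = (nodes K i \<omega> < s)"
    by (intro eventually_ball_finite ballI lt) simp
  with ev have "\<forall>\<^sub>F u in at_left s. simple_process K u \<omega> = simple_process K s \<omega>"
  proof eventually_elim
    case (elim u)
    have "(nodes K i \<omega> < u \<and> u \<le> nodes K (Suc i) \<omega>) = (nodes K i \<omega> < s \<and> s \<le> nodes K (Suc i) \<omega>)"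
      if "i < pieces K" for i
      using elim(2)[rule_format, of i] elim(2)[rule_format, of "Suc i"] that by (simp flip: not_less)
    then show ?case using elim s by (simp add: simple_process_def)
  qed
  then show ?thesis unfolding continuous_within by (rule tendsto_eventually)
qed

lemma simple_integral_right_continuous:
  assumes X: "\<And>s. 0 \<le> s \<Longrightarrow> continuous (at_right s) (\<lambda>t. X t \<omega>)" and s: "0 \<le> s"
  shows "continuous (at_right s) (\<lambda>t. simple_integral X K t \<omega>)"
proof -
  have m: "continuous (at_right s) (\<lambda>t. X (min T t) \<omega>)" for T
  proof (cases "s < T")
    case True
    have "((\<lambda>t. X t \<omega>) \<longlongrightarrow> X (min T s) \<omega>) (at_right s)"
      using X[OF s] True by (simp add: continuous_within)
    moreover have "\<forall>\<^sub>F t in at_right s. X t \<omega> = X (min T t) \<omega>"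
      using True by (auto simp: eventually_at_right_field intro!: exI[of _ T])
    ultimately show ?thesis unfolding continuous_within by (rule Lim_transform_eventually)
  next
    case False
    then have "\<forall>\<^sub>F t in at_right s. X (min T t) \<omega> = X (min T s) \<omega>"
      by (auto simp: eventually_at_right_field min_def intro!: exI[of _ "s + 1"])
    then show ?thesis unfolding continuous_within by (rule tendsto_eventually)
  qed
  show ?thesis unfolding simple_integral_def by (intro continuous_intros m)
qed

lemma caglad_cong:
  assumes "\<And>t. 0 \<le> t \<Longrightarrow> f t = g t" "caglad f" shows "caglad g"
proof -
  have l: "\<forall>\<^sub>F u in at_left t. f u = g u" if "0 < t" for t
    using that assms(1) by (auto simp: eventually_at_left_field intro!: exI[of _ 0])
  have r: "\<forall>\<^sub>F u in at_right t. f u = g u" if "0 \<le> t" for t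
    using that assms(1) by (auto simp: eventually_at_right_field intro!: exI[of _ "t + 1"])
  show ?thesis
    using assms(2) tendsto_cong[OF l] tendsto_cong[OF r] assms(1)
    unfolding caglad_def continuous_within by auto
qed

section \<open>From stochastic integrals to paths, and invariance under indistinguishability\<close>

context complete_filtration
begin

text \<open>The existence clause of the definition supplies a sequence of simple processes, and the
  universal clause makes its integrals converge to Z. The rest is measurability of the exceedance
  events.\<close>

lemma stochastic_integral_path_approx:
  assumes int: "stochastic_integral M F X H Z"
  shows "AE \<omega> in M. \<forall>t\<ge>0. \<forall>e>0. \<exists>K. nodes K 0 \<omega> = 0 \<and>
    (\<forall>i<pieces K. nodes K i \<omega> \<le> nodes K (Suc i) \<omega>) \<and>
    (\<forall>s\<in>{0..t}. \<bar>simple_process K s \<omega> - H s \<omega>\<bar> \<le> e) \<and>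
    (\<forall>s\<in>{0..t}. \<bar>simple_integral X K s \<omega> - Z s \<omega>\<bar> \<le> e)"
proof -
  have X: "adapted F X" "AE \<omega> in M. cadlag (\<lambda>t. X t \<omega>)"
    and H: "adapted F H" "AE \<omega> in M. caglad (\<lambda>t. H t \<omega>)"
    and Z: "adapted F Z" "AE \<omega> in M. cadlag (\<lambda>t. Z t \<omega>)"
    using int by (auto simp: stochastic_integral_def)
  obtain K where K: "\<And>n. simple_predictable M F (K n)" "ucp_tendsto M (\<lambda>n. simple_process (K n)) H"
    "ucp_tendsto M (\<lambda>n. simple_integral X (K n)) Z"
    using int unfolding stochastic_integral_def by metis
  have "AE \<omega> in M. \<forall>t\<ge>0. \<forall>e>0. \<exists>n.
    (\<forall>s\<in>{0..t}. \<bar>simple_process (K n) s \<omega> - H s \<omega>\<bar> \<le> e) \<and>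
    (\<forall>s\<in>{0..t}. \<bar>simple_integral X (K n) s \<omega> - Z s \<omega>\<bar> \<le> e)"
  proof (rule ucp_tendsto_AE_approx[OF K(2,3)])
    fix n t e assume t: "0 \<le> (t::real)"
    show "{\<omega> \<in> space M. \<exists>s\<in>{0..t}. e < \<bar>simple_process (K n) s \<omega> - H s \<omega>\<bar>} \<in> sets M"
    proof (rule sup_event_sets[OF t])
      show "(\<lambda>\<omega>. simple_process (K n) s \<omega> - H s \<omega>) \<in> borel_measurable M" if "0 \<le> s" for s
        by (intro borel_measurable_diff simple_process_measurable K adapted_measurable H that)
      from H(2) show "AE \<omega> in M. (\<forall>s>0. continuous (at_left s) (\<lambda>s. simple_process (K n) s \<omega> - H s \<omega>)) \<or>
          (\<forall>s\<ge>0. continuous (at_right s) (\<lambda>s. simple_process (K n) s \<omega> - H s \<omega>))"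
        by eventually_elim (auto simp: caglad_def intro!: continuous_diff simple_process_left_continuous)
    qed
    show "{\<omega> \<in> space M. \<exists>s\<in>{0..t}. e < \<bar>simple_integral X (K n) s \<omega> - Z s \<omega>\<bar>} \<in> sets M"
    proof (rule sup_event_sets[OF t])
      show "(\<lambda>\<omega>. simple_integral X (K n) s \<omega> - Z s \<omega>) \<in> borel_measurable M" if "0 \<le> s" for s
        by (intro borel_measurable_diff simple_integral_measurable K adapted_measurable X Z that)
      from Z(2) X(2) show "AE \<omega> in M. (\<forall>s>0. continuous (at_left s) (\<lambda>s. simple_integral X (K n) s \<omega> - Z s \<omega>)) \<or>
          (\<forall>s\<ge>0. continuous (at_right s) (\<lambda>s. simple_integral X (K n) s \<omega> - Z s \<omega>))"
      proof eventually_elim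
        case (elim \<omega>)
        then show ?case
          by (intro disjI2 allI impI continuous_diff simple_integral_right_continuous) (auto simp: cadlag_def)
      qed
    qed
  qed
  then show ?thesis
    using AE_space
  proof eventually_elim
    case (elim \<omega>)
    show ?case
    proof (intro allI impI)
      fix t e :: real assume "0 \<le> t" "0 < e"
      then obtain n where "\<forall>s\<in>{0..t}. \<bar>simple_process (K n) s \<omega> - H s \<omega>\<bar> \<le> e"
        "\<forall>s\<in>{0..t}. \<bar>simple_integral X (K n) s \<omega> - Z s \<omega>\<bar> \<le> e"
        using elim by blast
      then show "\<exists>K. nodes K 0 \<omega> = 0 \<and> (\<forall>i<pieces K. nodes K i \<omega> \<le> nodes K (Suc i) \<omega>) \<and>
          (\<forall>s\<in>{0..t}. \<bar>simple_process K s \<omega> - H s \<omega>\<bar> \<le> e) \<and>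
          (\<forall>s\<in>{0..t}. \<bar>simple_integral X K s \<omega> - Z s \<omega>\<bar> \<le> e)"
        using K(1)[of n] elim(2) by (intro exI[of _ "K n"]) (simp add: simple_predictable_def)
    qed
  qed
qed

text \<open>Preimages under the two processes differ within a null set. Completeness makes every
  subset of it a null set of M, and these lie in \<open>F 0\<close>, hence in every later
  \<open>F t\<close>.\<close>

lemma adapted_cong_AE:
  assumes H: "adapted F H" and eq: "AE \<omega> in M. \<forall>t\<ge>0. H t \<omega> = H' t \<omega>"
  shows "adapted F H'"
  unfolding adapted_def
proof (intro allI impI)
  fix t :: real assume t: "0 \<le> t"
  have null: "null_sets M \<subseteq> sets (F t)" using null_F sets_F_mono[OF t] by blast
  define P where "P = {\<omega> \<in> space M. H t \<omega> \<noteq> H' t \<omega>}"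
  have "AE \<omega> in M. H t \<omega> = H' t \<omega>" using eq t by auto
  then have P: "P \<in> null_sets M" unfolding P_def AE_iff_null_sets .
  show "H' t \<in> borel_measurable (F t)"
  proof (rule measurableI)
    fix B :: "real set" assume B: "B \<in> sets borel"
    have "H t \<in> borel_measurable (F t)" using H t by (simp add: adapted_def)
    from measurable_sets[OF this B] have HB: "H t -` B \<inter> space M \<in> sets (F t)" by (simp add: space_F)
    have "(H' t -` B \<inter> space M) \<inter> P \<in> null_sets M" by (rule complete2[OF _ P]) auto
    then have "(H t -` B \<inter> space M - P) \<union> ((H' t -` B \<inter> space M) \<inter> P) \<in> sets (F t)"
      using HB P null by blast
    also have "(H t -` B \<inter> space M - P) \<union> ((H' t -` B \<inter> space M) \<inter> P) = H' t -` B \<inter> space M"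
      by (auto simp: P_def)
    finally show "H' t -` B \<inter> space (F t) \<in> sets (F t)" by (simp add: space_F)
  qed simp
qed

lemma ucp_tendsto_cong_AE:
  assumes eq: "AE \<omega> in M. \<forall>t\<ge>0. H t \<omega> = H' t \<omega>"
  shows "ucp_tendsto M A H \<longleftrightarrow> ucp_tendsto M A H'"
proof -
  have "measure M {\<omega> \<in> space M. \<exists>s\<in>{0..t}. \<bar>A n s \<omega> - H s \<omega>\<bar> > e}
      = measure M {\<omega> \<in> space M. \<exists>s\<in>{0..t}. \<bar>A n s \<omega> - H' s \<omega>\<bar> > e}" for n t e
    by (rule measure_cong_AE) (use eq in eventually_elim, auto)
  then show ?thesis by (simp add: ucp_tendsto_def)
qed

lemma stochastic_integral_cong_AE:
  assumes int: "stochastic_integral M F X H Z" and eq: "AE \<omega> in M. \<forall>t\<ge>0. H t \<omega> = H' t \<omega>"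
  shows "stochastic_integral M F X H' Z"
proof -
  have "AE \<omega> in M. caglad (\<lambda>t. H t \<omega>)" using int by (simp add: stochastic_integral_def)
  then have "AE \<omega> in M. caglad (\<lambda>t. H' t \<omega>)" using eq
  proof eventually_elim
    case (elim \<omega>)
    show ?case by (rule caglad_cong[OF _ elim(1)]) (use elim(2) in simp)
  qed
  moreover have "adapted F H'" using int adapted_cong_AE[OF _ eq] by (simp add: stochastic_integral_def)
  ultimately show ?thesis
    using int unfolding stochastic_integral_def ucp_tendsto_cong_AE[OF eq] by simp
qed

end

theorem theorem2p2:
  fixes M :: "'a measure" and F :: "real \<Rightarrow> 'a measure"
    and L Y V G \<sigma>2 :: "real \<Rightarrow> 'a \<Rightarrow> real"
    and \<alpha>\<^sub>0 \<alpha>\<^sub>1 \<beta>\<^sub>1 \<omega>\<^sub>0 \<omega>\<^sub>1 \<eta> :: real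
  assumes "prob_space M" and "complete_measure M"
    and "levy_process M L"
    and "levy_measure M L \<noteq> null_measure borel"
    and "Y 0 \<in> borel_measurable M"
    and "prob_space.indep_set M
           (sets (vimage_algebra (space M) (Y 0) borel))
           (sets (vimage_algebra (space M) (\<lambda>\<omega>. \<lambda>t\<in>{0..}. L t \<omega>) (PiM {0..} (\<lambda>_. borel))))"
    and "smallest_filtration M L (Y 0) F"
    and "\<alpha>\<^sub>0 > 0" and "\<alpha>\<^sub>1 > 0" and "\<beta>\<^sub>1 > 0"
    and "state_process M F L (- \<beta>\<^sub>1) \<alpha>\<^sub>1 \<alpha>\<^sub>0 Y"
    and "V = volatility \<alpha>\<^sub>1 \<alpha>\<^sub>0 Y"
    and "AE \<omega> in M. \<forall>t\<ge>0. V t \<omega> \<ge> 0"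
    and "AE \<omega> in M. G 0 \<omega> = 0"
    and "stochastic_integral M F L (\<lambda>t \<omega>. sqrt (V t \<omega>)) G"
    and "\<omega>\<^sub>0 = \<alpha>\<^sub>0 * \<beta>\<^sub>1" and "\<omega>\<^sub>1 = \<alpha>\<^sub>1 * exp (- \<beta>\<^sub>1)" and "\<eta> = \<beta>\<^sub>1"
    and "\<sigma>2 = cogarch_sigma_sq L \<omega>\<^sub>0 \<omega>\<^sub>1 \<eta> (V 0)"
  shows "(AE \<omega> in M. \<forall>t\<ge>0. V t \<omega> = \<sigma>2 t \<omega>) \<and>
         (AE \<omega> in M. G 0 \<omega> = 0) \<and>
         stochastic_integral M F L (\<lambda>t \<omega>. sqrt (\<sigma>2 t \<omega>)) G"
proof -
  interpret P: prob_space M by fact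
  interpret C: complete_measure M by fact
  have adm: "admissible_filtration M L (Y 0) F"
    using assms(7) by (simp add: smallest_filtration_def)
  then interpret filtration "space M" F unfolding admissible_filtration_def by blast
  interpret complete_filtration M F
    by unfold_locales (use adm in \<open>(unfold admissible_filtration_def, blast)+\<close>)
  obtain Z where cY: "AE \<omega> in M. cadlag (\<lambda>t. Y t \<omega>)"
    and Z: "stochastic_integral M F (discrete_quadratic_variation L)
            (\<lambda>t \<omega>. \<alpha>\<^sub>0 + \<alpha>\<^sub>1 * left_limit (\<lambda>s. Y s \<omega>) t) Z"
    and Y: "AE \<omega> in M. \<forall>t\<ge>0.
           Y t \<omega> = Y 0 \<omega> + (LINT s:{0..t}|lborel. - \<beta>\<^sub>1 * left_limit (\<lambda>u. Y u \<omega>) s) + Z t \<omega>"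
    using assms(11) unfolding state_process_def by blast
  have cD: "AE \<omega> in M. cadlag (\<lambda>t. discrete_quadratic_variation L t \<omega>)"
    using Z by (simp add: stochastic_integral_def)
  \<comment> \<open>The factor exp (- \<beta>) in \<open>\<omega>\<^sub>1\<close> is there to cancel
    exp (\<eta>), so the logarithms in \<open>cogarch_X\<close> have coefficient
    \<open>\<alpha>\<^sub>1\<close>, as the linear equation requires.\<close>
  have \<omega>\<^sub>1: "\<omega>\<^sub>1 * exp \<eta> = \<alpha>\<^sub>1" using assms(17,18) by (simp add: exp_minus)
  have V: "AE \<omega> in M. \<forall>t\<ge>0. V t \<omega> = \<sigma>2 t \<omega>"
    using cD cY Y stochastic_integral_path_approx[OF Z]
  proof eventually_elim
    case (elim \<omega>)
    have "V t \<omega> = \<sigma>2 t \<omega>" if t: "0 < t" for t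
    proof -
      have "\<alpha>\<^sub>0 + \<alpha>\<^sub>1 * left_limit (\<lambda>s. Y s \<omega>) t =
        (\<alpha>\<^sub>0 + \<alpha>\<^sub>1 * Y 0 \<omega> + \<alpha>\<^sub>0 * \<beta>\<^sub>1 * (LINT s:{0..t}|lborel. exp (cogarch_X L \<omega>\<^sub>1 \<eta> s \<omega>)))
          * exp (- left_limit (\<lambda>s. cogarch_X L \<omega>\<^sub>1 \<eta> s \<omega>) t)"
      proof (rule volatility_path_formula[where q = "\<lambda>s. (jump (\<lambda>u. L u \<omega>) s)\<^sup>2" and z = "\<lambda>t. Z t \<omega>" and \<omega> = \<omega>
            and h = "\<lambda>t. \<alpha>\<^sub>0 + \<alpha>\<^sub>1 * left_limit (\<lambda>s. Y s \<omega>) t" and y = "\<lambda>t. Y t \<omega>"])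
        show "cogarch_X L \<omega>\<^sub>1 \<eta> t \<omega> = \<beta>\<^sub>1 * t - (\<Sum>\<^sub>\<infinity>s\<in>{0<..t}. ln (1 + \<alpha>\<^sub>1 * (jump (\<lambda>u. L u \<omega>) s)\<^sup>2))" for t
          using assms(18) \<omega>\<^sub>1 by (simp add: cogarch_X_def)
        fix t e :: real assume "0 \<le> t" "0 < e"
        then show "\<exists>K. nodes K 0 \<omega> = 0 \<and> (\<forall>i<pieces K. nodes K i \<omega> \<le> nodes K (Suc i) \<omega>) \<and>
          (\<forall>s\<in>{0..t}. \<bar>simple_process K s \<omega> - (\<alpha>\<^sub>0 + \<alpha>\<^sub>1 * left_limit (\<lambda>s. Y s \<omega>) s)\<bar> \<le> e) \<and>
          (\<forall>s\<in>{0..t}. \<bar>simple_integral (\<lambda>t _. \<Sum>\<^sub>\<infinity>s\<in>{0<..t}. (jump (\<lambda>u. L u \<omega>) s)\<^sup>2) K s \<omega> - Z s \<omega>\<bar> \<le> e)"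
          using elim(4) by (simp add: simple_integral_def discrete_quadratic_variation_def)
      next
        show "cadlag (\<lambda>t. \<Sum>\<^sub>\<infinity>s\<in>{0<..t}. (jump (\<lambda>u. L u \<omega>) s)\<^sup>2)"
          using elim(1) by (simp add: discrete_quadratic_variation_def)
        show "Y t \<omega> = Y 0 \<omega> + (LINT s:{0..t}|lborel. - \<beta>\<^sub>1 * left_limit (\<lambda>t. Y t \<omega>) s) + Z t \<omega>" if "0 \<le> t" for t
          using elim(3) that by blast
      qed (fact elim(2) assms(9,10) t | simp)+
      then show ?thesis using t assms(12,16,19) by (simp add: volatility_def cogarch_sigma_sq_def)
    qed
    \<comment> \<open>Time 0 is separate because \<open>V 0\<close> is built from \<open>Y 0\<close>
      and not from a left limit. The integral over one point vanishes and X has left limit 0 there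
      by convention, so \<open>\<sigma>2 0\<close> reduces to \<open>V 0\<close>.\<close>
    moreover have "(LINT s:{0..0}|lborel. exp (cogarch_X L \<omega>\<^sub>1 \<eta> s \<omega>)) = 0"
      unfolding set_lebesgue_integral_def
      by (rule integral_eq_zero_AE) (use AE_lborel_singleton[of 0] in eventually_elim, simp)
    then have "V 0 \<omega> = \<sigma>2 0 \<omega>"
      using assms(19) by (simp add: cogarch_sigma_sq_def left_limit_def)
    ultimately show ?case by (metis order_le_less)
  qed
  moreover have "stochastic_integral M F L (\<lambda>t \<omega>. sqrt (\<sigma>2 t \<omega>)) G"
    by (rule stochastic_integral_cong_AE[OF assms(15)]) (use V in eventually_elim, simp)
  ultimately show ?thesis using assms(14) by blast
qed

end
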